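(* Suppose $C\subset\mathbb{C}P^2$ is an irreducible complex algebraic curve of degree $d$ whose singular points are $a$ ordinary double points and $b$ ordinary cusps. Then $$b\le \tfrac12(d-1)(d-2)-\tfrac12A(d)-\tfrac12a,$$ where $$A(d)=\begin{cases}\dfrac{d^2-6d+5}{4}&\text{if } d \text{ is odd},\\[2mm] \dfrac{d^2-6d+4}{4}&\text{if } d\text{ is even}.\end{cases}$$
   Context: An ordinary double point is a singular point whose link is the positive Hopf link $T(2,2)$; an ordinary cusp is a singular point whose link is the positive trefoil $T(2,3)$. *)

theory Defs
  imports "HOL-Analysis.Analysis" "HOL-Computational_Algebra.Computational_Algebra"
begin

section \<open>Plane projective curves\<close>

text \<open>
  The ring \<open>\<complex>[x,y,z]\<close> is the iterated polynomial ring \<open>\<complex>[x][y][z]\<close>: the coefficient of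
  \<open>x^i y^j z^k\<close> in \<open>F\<close> is \<open>coeff (coeff (coeff F k) j) i\<close>.
\<close>

type_synonym poly3 = "complex poly poly poly"

definition eval3 :: "poly3 \<Rightarrow> complex^3 \<Rightarrow> complex" where
  "eval3 F v = poly (poly (poly F [:[:v$3:]:]) [:v$2:]) (v$1)"

definition homogeneous_of_degree :: "nat \<Rightarrow> poly3 \<Rightarrow> bool" where
  "homogeneous_of_degree d F \<longleftrightarrow>
     F \<noteq> 0 \<and> (\<forall>i j k. coeff (coeff (coeff F k) j) i \<noteq> 0 \<longrightarrow> i + j + k = d)"

text \<open>Points of the projective plane are the one-dimensional subspaces of \<open>\<complex>^3\<close>.\<close>

definition CP2 :: "(complex^3) set set" where
  "CP2 = {vec.span {v} | v. v \<noteq> 0}"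

text \<open>The following two sets are meant for homogeneous \<open>F\<close>.\<close>

definition curve :: "poly3 \<Rightarrow> (complex^3) set set" where
  "curve F = {P \<in> CP2. \<forall>v\<in>P - {0}. eval3 F v = 0}"

definition singular_points :: "poly3 \<Rightarrow> (complex^3) set set" where
  "singular_points F =
     {P \<in> curve F. \<forall>v\<in>P - {0}. (eval3 F has_derivative (\<lambda>_. 0)) (at v)}"

section \<open>Oriented links in the three-sphere\<close>

text \<open>
  The three-sphere is \<open>sphere 0 1\<close> in \<open>\<complex>\<^sup>2\<close>. An oriented link is given by a list of
  parametrizations of its components, each a regular loop of period 1; these matter only
  up to order and orientation-preserving reparametrization, see \<open>link_isotopic\<close>.
\<close>

definition oriented_knot :: "(real \<Rightarrow> complex \<times> complex) \<Rightarrow> bool" where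
  "oriented_knot \<gamma> \<longleftrightarrow>
     range \<gamma> \<subseteq> sphere 0 1 \<and>
     \<gamma> C1_differentiable_on UNIV \<and>
     (\<forall>t. vector_derivative \<gamma> (at t) \<noteq> 0) \<and>
     (\<forall>s t. \<gamma> s = \<gamma> t \<longleftrightarrow> s - t \<in> \<int>)"

definition oriented_link :: "(real \<Rightarrow> complex \<times> complex) list \<Rightarrow> bool" where
  "oriented_link L \<longleftrightarrow>
     (\<forall>\<gamma>\<in>set L. oriented_knot \<gamma>) \<and>
     (\<forall>i<length L. \<forall>j<length L. i \<noteq> j \<longrightarrow> range (L ! i) \<inter> range (L ! j) = {})"

text \<open>Ambient isotopy of oriented links; \<open>\<phi>\<close> lifts an orientation-preserving
  homeomorphism of the circle \<open>\<real>/\<int>\<close>.\<close>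

definition link_isotopic ::
  "(real \<Rightarrow> complex \<times> complex) list \<Rightarrow> (real \<Rightarrow> complex \<times> complex) list \<Rightarrow> bool" where
  "link_isotopic L M \<longleftrightarrow>
     (\<exists>h :: real \<Rightarrow> complex \<times> complex \<Rightarrow> complex \<times> complex.
        continuous_on ({0..1} \<times> sphere 0 1) (\<lambda>(s, x). h s x) \<and>
        (\<forall>s\<in>{0..1}. \<exists>g. homeomorphism (sphere 0 1) (sphere 0 1) (h s) g) \<and>
        (\<forall>x\<in>sphere 0 1. h 0 x = x) \<and>
        (\<exists>\<pi>. bij_betw \<pi> {..<length L} {..<length M} \<and>
          (\<forall>i<length L. \<exists>\<phi> :: real \<Rightarrow> real.
             continuous_on UNIV \<phi> \<and> strict_mono \<phi> \<and> (\<forall>t. \<phi> (t + 1) = \<phi> t + 1) \<and>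
             (\<forall>t. h 1 ((L ! i) t) = (M ! \<pi> i) (\<phi> t)))))"

text \<open>
  The positive torus link \<open>T(p,q)\<close>, for \<open>p, q > 0\<close>, is \<open>{(z,w). z^p = w^q}\<close> on the torus
  \<open>|z| = |w| = 1/\<surd>2\<close>, with \<open>gcd p q\<close> components.
\<close>

definition torus_link :: "nat \<Rightarrow> nat \<Rightarrow> (real \<Rightarrow> complex \<times> complex) list" where
  "torus_link p q =
     map (\<lambda>k t. (1 / sqrt 2) *\<^sub>R
            (cis (2 * pi * (real (q div gcd p q) * t)),
             cis (2 * pi * (real (p div gcd p q) * t + real k / real q))))
       [0..<gcd p q]"

section \<open>Links of singular points\<close>

text \<open>
  \<open>L\<close> is the oriented link cut out by \<open>f = 0\<close> on the sphere of radius \<open>\<epsilon>\<close>, rescaled to the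
  unit sphere. The link is oriented as the boundary of the complex curve \<open>{f = 0}\<close> in the ball
  of radius \<open>\<epsilon>\<close>: if \<open>n\<close> is the outward normal at \<open>x\<close>, i.e. a positive multiple of the orthogonal
  projection of \<open>x\<close> to the complex tangent line, then the positive tangent vectors \<open>v\<close> are the
  positive multiples of \<open>\<i> n\<close>. Among the tangent vectors of the link these are the ones
  having positive real inner product with \<open>\<i> x\<close>.
\<close>

definition link_at_radius ::
  "(complex \<times> complex \<Rightarrow> complex) \<Rightarrow> real \<Rightarrow> (real \<Rightarrow> complex \<times> complex) list \<Rightarrow> bool" where
  "link_at_radius f \<epsilon> L \<longleftrightarrow>
     oriented_link L \<and>
     (\<Union>\<gamma>\<in>set L. range \<gamma>) = {x \<in> sphere 0 1. f (\<epsilon> *\<^sub>R x) = 0} \<and>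
     (\<forall>\<gamma>\<in>set L. \<forall>t.
        vector_derivative \<gamma> (at t) \<bullet> (\<i> * fst (\<gamma> t), \<i> * snd (\<gamma> t)) > 0)"

text \<open>
  An invertible matrix \<open>A\<close> whose first column spans \<open>P\<close> gives an affine chart of the
  projective plane centred at \<open>P\<close>, sending \<open>(s,t)\<close> to the point spanned by \<open>A (1,s,t)\<close>.
  The link of the curve at \<open>P\<close> is taken in such a chart; its isotopy class does not depend on
  the chart, nor on the radius when this is small.
\<close>

definition local_equation :: "poly3 \<Rightarrow> complex^3^3 \<Rightarrow> complex \<times> complex \<Rightarrow> complex" where
  "local_equation F A = (\<lambda>(s, t). eval3 F (A *v vector [1, s, t]))"

definition has_link ::
  "poly3 \<Rightarrow> (complex^3) set \<Rightarrow> (real \<Rightarrow> complex \<times> complex) list \<Rightarrow> bool" where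
  "has_link F P T \<longleftrightarrow>
     (\<exists>A. invertible A \<and> column 1 A \<in> P \<and>
        (\<exists>\<epsilon>\<^sub>0>0. \<forall>\<epsilon>. 0 < \<epsilon> \<and> \<epsilon> < \<epsilon>\<^sub>0 \<longrightarrow>
           (\<exists>L. link_at_radius (local_equation F A) \<epsilon> L \<and> link_isotopic L T)))"

definition ordinary_double_point :: "poly3 \<Rightarrow> (complex^3) set \<Rightarrow> bool" where
  "ordinary_double_point F P \<longleftrightarrow> P \<in> singular_points F \<and> has_link F P (torus_link 2 2)"

definition ordinary_cusp :: "poly3 \<Rightarrow> (complex^3) set \<Rightarrow> bool" where
  "ordinary_cusp F P \<longleftrightarrow> P \<in> singular_points F \<and> has_link F P (torus_link 2 3)"

definition A_bound :: "nat \<Rightarrow> real" where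
  "A_bound d = (if odd d then (real d ^ 2 - 6 * real d + 5) / 4
                else (real d ^ 2 - 6 * real d + 4) / 4)"

end

theory Submission
  imports "HOL-Computational_Algebra.Field_as_Ring" "Subresultants.Subresultant_Gcd" Defs
begin

text \<open>
  The asserted bound says \<open>4 a + 8 b \<le> 3 d\<^sup>2 - 6 d + 3\<close> (with \<open>4\<close> in place of the last \<open>3\<close> if
  \<open>d\<close> is even). For a curve without singular points this is clear. Otherwise \<open>d \<ge> 2\<close>, and
  the bound is a numerical consequence of the classical estimate for the class of the curve,
  \<open>2 a + 3 b \<le> d (d - 1) - 1\<close>: for \<open>d \<ge> 8\<close> multiply this by \<open>8/3\<close>, and for \<open>2 \<le> d \<le> 7\<close> use in
  addition that \<open>a + 2 b\<close> is an integer. The last \<open>- 1\<close> in the class estimate is needed: a sextic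
  with ten cusps would satisfy \<open>2 a + 3 b = d (d - 1)\<close>.

  The class estimate is obtained by projecting the curve from one of its own points \<open>q\<close>, which is
  chosen off the finitely many lines that join two singular points (\<open>exists_projection_centre\<close>; an
  irreducible curve of degree at least 2 contains no line). In an affine chart whose line at
  infinity passes through \<open>q\<close> and misses the singular points, and whose vertical lines are the
  other lines through \<open>q\<close>, the curve has an equation \<open>G(x, y) = 0\<close>, and the singular points
  have different first coordinates. Let \<open>R(x)\<close> be the resultant of \<open>G\<close> and \<open>\<partial>G/\<partial>y\<close> with respect to \<open>y\<close>.

  \<^item> Since \<open>q\<close> lies on the curve, \<open>G\<close> has degree at most \<open>d - 1\<close> in \<open>y\<close>, and counting weights in the
    Sylvester matrix gives \<open>deg R \<le> d\<^sup>2 - d - 1\<close> (\<open>degree_discriminant_le\<close>).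
  \<^item> \<open>R\<close> is not zero, for otherwise \<open>G\<close> is divisible by a square and the curve has infinitely
    many singular points (\<open>discriminant_nonzero\<close>).
  \<^item> \<open>R\<close> vanishes to order at least 2 at the first coordinate of a singular point, and to order at
    least 3 if the quadratic part of the local equation is degenerate (\<open>discriminant_order\<close>).

  So the only thing to be learned from the topology is that the quadratic part of the local
  equation at an ordinary cusp is degenerate (\<open>cusp_tangent_cone_degenerate\<close>). If it is not, it is
  a product \<open>s t\<close> of two linear forms, and every point of the link of small radius is close to exactly
  one of the lines \<open>s = 0\<close> and \<open>t = 0\<close>. There are link points near both, by Brouwer's fixed point
  theorem, so the link is disconnected. But the trefoil, being a knot, is connected, and an
  isotopy of links preserves the number of components.
\<close>

hide_const (open) Determinants.det Finite_Cartesian_Product.mat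
no_notation fps_nth (infixl "$" 75)
no_notation vec_index (infixl "$" 100)

section \<open>Vanishing orders and degrees of resultants\<close>

lemma det_dvd_row:
  fixes M :: "'a::comm_ring_1 mat"
  assumes M: "M \<in> carrier_mat n n" and i: "i < n" and dvd: "\<And>j. j < n \<Longrightarrow> x dvd M $$ (i, j)"
  shows "x dvd det M"
  unfolding laplace_expansion_row[OF M i] by (intro dvd_sum dvd_mult2) (auto intro: dvd)

lemma det_combine_rows:
  fixes M :: "'a::comm_ring_1 mat"
  assumes M: "M \<in> carrier_mat n n" and r: "r < n"
  shows "det (mat n n (\<lambda>(i, j). if i = r then \<Sum>k<n. u k * M $$ (k, j) else M $$ (i, j))) = u r * det M"
    (is "det ?M' = _")
proof -
  have M': "?M' \<in> carrier_mat n n" by simp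
  have cof: "cofactor ?M' r j = cofactor M r j" if "j < n" for j
  proof -
    have "mat_delete ?M' r j = mat_delete M r j"
      using M r that by (intro eq_matI) (auto simp: mat_delete_def)
    thus ?thesis by (simp add: cofactor_def)
  qed
  have adj: "(\<Sum>j<n. M $$ (k, j) * cofactor M r j) = (if k = r then det M else 0)" if "k < n" for k
  proof -
    have "(M * adj_mat M) $$ (k, r) = (det M \<cdot>\<^sub>m 1\<^sub>m n) $$ (k, r)"
      using adj_mat(2)[OF M] by simp
    moreover have "(M * adj_mat M) $$ (k, r) = (\<Sum>j<n. M $$ (k, j) * cofactor M r j)"
      using M that r by (auto simp: adj_mat_def scalar_prod_def times_mat_def lessThan_atLeast0)
    ultimately show ?thesis using that r by auto
  qed
  have "det ?M' = (\<Sum>j<n. (\<Sum>k<n. u k * M $$ (k, j)) * cofactor M r j)"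
    unfolding laplace_expansion_row[OF M' r] using r by (intro sum.cong) (auto simp: cof)
  also have "\<dots> = (\<Sum>k<n. u k * (\<Sum>j<n. M $$ (k, j) * cofactor M r j))"
    by (simp add: sum_distrib_left sum_distrib_right mult.assoc) (rule sum.swap)
  also have "\<dots> = (\<Sum>k<n. if k = r then u r * det M else 0)"
    by (intro sum.cong) (auto simp: adj)
  also have "\<dots> = u r * det M" using r by simp
  finally show ?thesis .
qed

lemma det_combine_columns:
  fixes M :: "'a::comm_ring_1 mat"
  assumes M: "M \<in> carrier_mat n n" and q: "q < n"
  shows "det (mat n n (\<lambda>(i, j). if j = q then \<Sum>k<n. M $$ (i, k) * w k else M $$ (i, j))) = w q * det M"
    (is "det ?M' = _")
proof -
  have "det ?M' = det (transpose_mat ?M')" by (simp only: Determinant.det_transpose[OF mat_carrier])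
  also have "transpose_mat ?M' =
      mat n n (\<lambda>(i, j). if i = q then \<Sum>k<n. w k * transpose_mat M $$ (k, j) else transpose_mat M $$ (i, j))"
    using M by (intro eq_matI) (auto simp: mult.commute)
  also have "det \<dots> = w q * det (transpose_mat M)" 
    using M q by (intro det_combine_rows) auto
  also have "det (transpose_mat M) = det M" by (rule Determinant.det_transpose[OF M])
  finally show ?thesis .
qed

text \<open>
  A matrix that is singular modulo \<open>x\<close> has determinant divisible by \<open>x\<close>; this is a version of higher
  order. Replacing the row \<open>r\<close> by the combination \<open>u\<close> of the rows and the column \<open>q\<close> by the combination
  \<open>w\<close> of the columns changes the determinant by a unit only. Afterwards \<open>x\<close> divides the new row and
  \<open>x ^ k\<close> the new column, and their common entry is divisible by \<open>x ^ Suc k\<close>. Every term of the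
  expansion along the new column now contains \<open>x ^ Suc k\<close>.
\<close>

lemma power_dvd_det:
  fixes M :: "'a::comm_ring_1 mat"
  assumes M: "M \<in> carrier_mat n n" and r: "r < n" and q: "q < n"
    and row: "\<And>j. j < n \<Longrightarrow> x dvd (\<Sum>i<n. u i * M $$ (i, j))"
    and col: "\<And>i. i < n \<Longrightarrow> x ^ k dvd (\<Sum>j<n. M $$ (i, j) * w j)"
    and corner: "x ^ Suc k dvd (\<Sum>i<n. u i * (\<Sum>j<n. M $$ (i, j) * w j))"
    and ur: "u r dvd 1" and wq: "w q dvd 1"
  shows "x ^ Suc k dvd det M"
proof -
  define C where "C = mat n n (\<lambda>(i, j). if j = q then \<Sum>k<n. M $$ (i, k) * w k else M $$ (i, j))"
  define R where "R = mat n n (\<lambda>(i, j). if i = r then \<Sum>k<n. u k * C $$ (k, j) else C $$ (i, j))"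
  have C: "C \<in> carrier_mat n n" and R: "R \<in> carrier_mat n n" by (simp_all add: C_def R_def)
  have "x ^ Suc k dvd R $$ (i, q) * cofactor R i q" if i: "i < n" for i
  proof (cases "i = r")
    case True
    have "R $$ (r, q) = (\<Sum>i<n. u i * (\<Sum>j<n. M $$ (i, j) * w j))"
      using r q by (simp add: R_def C_def)
    thus ?thesis using corner True by (metis dvd_mult2)
  next
    case False
    have "R $$ (i, q) = (\<Sum>j<n. M $$ (i, j) * w j)"
      using False i q by (simp add: R_def C_def)
    hence 1: "x ^ k dvd R $$ (i, q)" using col[OF i] by simp
    \<comment> \<open>the minor keeps the row \<open>r\<close>, which is divisible by \<open>x\<close> and moves up if it stood below \<open>i\<close>\<close>
    define r' where "r' = (if r < i then r else r - 1)"
    have D: "mat_delete R i q \<in> carrier_mat (n - 1) (n - 1)" using R by (auto simp: mat_delete_def)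
    have r': "r' < n - 1" using r i False by (auto simp: r'_def)
    have "x dvd mat_delete R i q $$ (r', j)" if j: "j < n - 1" for j
    proof -
      define j' where "j' = (if j < q then j else Suc j)"
      have j': "j' < n" "j' \<noteq> q" using j by (auto simp: j'_def)
      have "mat_delete R i q $$ (r', j) = R $$ (r, j')"
        using R r' j False by (auto simp: mat_delete_def r'_def j'_def)
      also have "\<dots> = (\<Sum>k<n. u k * M $$ (k, j'))"
        using r j' by (simp add: R_def C_def)
      finally show ?thesis using row[OF j'(1)] by simp
    qed
    hence "x dvd det (mat_delete R i q)" by (rule det_dvd_row[OF D r'])
    hence "x dvd cofactor R i q" by (simp add: cofactor_def)
    with 1 have "x ^ k * x dvd R $$ (i, q) * cofactor R i q" by (rule mult_dvd_mono)
    thus ?thesis by (simp add: mult.commute)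
  qed
  hence "x ^ Suc k dvd det R"
    unfolding laplace_expansion_column[OF R q] by (intro dvd_sum) auto
  also have "det R = u r * (w q * det M)"
    unfolding R_def det_combine_rows[OF C r] by (simp add: C_def det_combine_columns[OF M q])
  finally have "x ^ Suc k dvd (u r * w q) * det M" by (simp add: mult.assoc)
  moreover have "u r * w q dvd 1" using mult_dvd_mono[OF ur wq] by simp
  then obtain z where z: "1 = u r * w q * z" by (rule dvdE)
  have "det M = u r * w q * z * det M" by (simp flip: z)
  hence "det M = z * (u r * w q * det M)" by (simp add: mult_ac)
  ultimately show ?thesis by (metis dvd_mult)
qed

lemma sum_reversed_coeffs_eq_poly:
  fixes h :: "'a::comm_ring_1 poly"
  assumes "degree h < n"
  shows "(\<Sum>j<n. coeff h (n - 1 - j) * c ^ (n - 1 - j)) = poly h c"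
proof -
  have "(\<Sum>j<n. coeff h (n - 1 - j) * c ^ (n - 1 - j)) = (\<Sum>j<n. coeff h j * c ^ j)"
    by (rule sum.reindex_bij_witness[of _ "\<lambda>j. n - 1 - j" "\<lambda>j. n - 1 - j"]) auto
  also have "\<dots> = (\<Sum>j\<le>degree h. coeff h j * c ^ j)"
    using assms by (intro sum.mono_neutral_right) (auto simp: coeff_eq_0)
  finally show ?thesis by (simp add: poly_altdef)
qed

text \<open>
  The lemma \<open>power_dvd_det\<close> for the Sylvester matrix. A combination of its rows is a polynomial
  \<open>A * f + B * g\<close>, and the combination of its columns by the powers of \<open>c\<close> evaluates the polynomials in
  the rows at \<open>c\<close>. If \<open>f\<close> and \<open>g\<close> have a common root modulo \<open>x\<close>, then \<open>A\<close> and \<open>B\<close> come from dividing out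
  that root. Because \<open>c\<close> is arbitrary, the root need not be moved to 0, which would require that
  resultants are invariant under translations.
\<close>

lemma power_dvd_resultant:
  fixes f g A B :: "'a::idom poly" and c x :: 'a
  assumes dA: "degree A < degree g" and dB: "degree B < degree f"
    and row: "\<And>j. x dvd coeff (A * f + B * g) j"
    and col: "x ^ k dvd poly f c" "x ^ k dvd poly g c"
    and corner: "x ^ Suc k dvd poly (A * f + B * g) c"
    and unit: "coeff B p dvd 1"
  shows "x ^ Suc k dvd resultant f g"
proof -
  define m n where "m = degree f" and "n = degree g"
  define N where "N = m + n"
  define M where "M = sylvester_mat f g"
  \<comment> \<open>row \<open>i\<close> holds the coefficients of \<open>h i\<close>, the highest one first\<close>
  define h where "h i = (if i < n then monom 1 (n - 1 - i) * f else monom 1 (N - 1 - i) * g)" for i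
  define u where "u i = (if i < n then coeff A (n - 1 - i) else coeff B (N - 1 - i))" for i
  have M: "M \<in> carrier_mat N N" by (auto simp: M_def N_def m_def n_def)
  have n0: "n > 0" "m > 0" using dA dB by (auto simp: n_def m_def)
  have entry: "M $$ (i, j) = coeff (h i) (N - 1 - j)" if "i < N" "j < N" for i j
    using that unfolding M_def sylvester_index_mat2[OF that[unfolded N_def m_def n_def]]
    by (auto simp: h_def N_def m_def n_def coeff_monom_mult)
  have deg: "degree (h i) < N" if "i < N" for i
  proof -
    have "degree (monom 1 (n - 1 - i) * f) \<le> n - 1 - i + m" 
      using degree_mult_le[of "monom 1 (n - 1 - i)" f] degree_monom_le[of "1::'a" "n - 1 - i"] by (simp add: m_def)
    moreover have "degree (monom 1 (N - 1 - i) * g) \<le> N - 1 - i + n" 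
      using degree_mult_le[of "monom 1 (N - 1 - i)" g] degree_monom_le[of "1::'a" "N - 1 - i"] by (simp add: n_def)
    ultimately show ?thesis using that n0 by (auto simp: h_def N_def)
  qed
  have hsum: "(\<Sum>i<N. smult (u i) (h i)) = A * f + B * g"
  proof -
    have mono: "(\<Sum>i<l. smult (coeff H (l - 1 - i)) (monom 1 (l - 1 - i) * F)) = H * F"
      if "degree H < l" for H F :: "'a poly" and l
    proof -
      have "(\<Sum>i<l. smult (coeff H (l - 1 - i)) (monom 1 (l - 1 - i) * F)) = 
            (\<Sum>i<l. monom (coeff H i) i * F)"
        by (rule sum.reindex_bij_witness[of _ "\<lambda>j. l - 1 - j" "\<lambda>j. l - 1 - j"]) 
           (auto simp: smult_monom simp flip: mult_smult_left)
      also have "\<dots> = (\<Sum>i\<le>degree H. monom (coeff H i) i * F)"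
        using that by (intro sum.mono_neutral_right) (auto simp: coeff_eq_0)
      also have "\<dots> = H * F" unfolding sum_distrib_right[symmetric] poly_as_sum_of_monoms ..
      finally show ?thesis .
    qed
    have "{..<N} = {..<n} \<union> (\<lambda>i. n + i) ` {..<m}"
      using image_add_atLeastLessThan[of n 0 m] by (auto simp: N_def lessThan_atLeast0)
    hence "(\<Sum>i<N. smult (u i) (h i)) = (\<Sum>i<n. smult (u i) (h i)) + (\<Sum>i\<in>(\<lambda>i. n + i) ` {..<m}. smult (u i) (h i))"
      by (simp add: sum.union_disjoint[of "{..<n}"] image_iff disjoint_iff)
    also have "(\<Sum>i<n. smult (u i) (h i)) = A * f"
      using mono[of A n f] dA by (simp add: u_def h_def n_def)
    also have "(\<Sum>i\<in>(\<lambda>i. n + i) ` {..<m}. smult (u i) (h i)) = B * g"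
      using mono[of B m g] dB by (simp add: sum.reindex u_def h_def m_def N_def)
    finally show ?thesis .
  qed
  obtain r where r: "r < N" "u r dvd 1"
  proof
    have "p \<le> degree B" using unit by (cases "p \<le> degree B") (auto simp: coeff_eq_0)
    hence "p < m" using dB by (simp add: m_def)
    thus "N - 1 - p < N" "u (N - 1 - p) dvd 1" using unit n0 by (auto simp: u_def N_def)
  qed
  have col': "(\<Sum>j<N. M $$ (i, j) * c ^ (N - 1 - j)) = poly (h i) c" if "i < N" for i
    using sum_reversed_coeffs_eq_poly[OF deg[OF that], of c] that by (simp add: entry)
  show ?thesis
    unfolding resultant_def M_def[symmetric]
  proof (rule power_dvd_det[OF M r(1), where q = "N - 1" and w = "\<lambda>j. c ^ (N - 1 - j)" and u = u])
    show "N - 1 < N" using n0 by (simp add: N_def)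
    show "x dvd (\<Sum>i<N. u i * M $$ (i, j))" if "j < N" for j
    proof -
      have "(\<Sum>i<N. u i * M $$ (i, j)) = coeff (\<Sum>i<N. smult (u i) (h i)) (N - 1 - j)"
        using that by (simp add: coeff_sum entry)
      thus ?thesis using row by (simp add: hsum)
    qed
    show "x ^ k dvd (\<Sum>j<N. M $$ (i, j) * c ^ (N - 1 - j))" if "i < N" for i
      using col unfolding col'[OF that] by (auto simp: h_def poly_monom)
    have "(\<Sum>i<N. u i * (\<Sum>j<N. M $$ (i, j) * c ^ (N - 1 - j))) = (\<Sum>i<N. u i * poly (h i) c)"
      by (intro sum.cong refl arg_cong2[of _ _ _ _ "(*)"] col') simp
    also have "\<dots> = poly (\<Sum>i<N. smult (u i) (h i)) c"
      by (simp add: poly_sum)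
    finally show "x ^ Suc k dvd (\<Sum>i<N. u i * (\<Sum>j<N. M $$ (i, j) * c ^ (N - 1 - j)))"
      using corner by (simp add: hsum)
  qed (use r in auto)
qed

definition total_degree_le :: "nat \<Rightarrow> 'a::comm_ring_1 poly poly \<Rightarrow> bool" where
  "total_degree_le n G \<longleftrightarrow> (\<forall>j. coeff G j \<noteq> 0 \<longrightarrow> degree (coeff G j) + j \<le> n)"

lemma coeff_eq_0_if_total_degree_le:
  assumes "total_degree_le n G" "n < j"
  shows "coeff G j = 0"
proof (rule ccontr)
  assume "coeff G j \<noteq> 0"
  hence "degree (coeff G j) + j \<le> n" using assms(1) by (simp add: total_degree_le_def)
  thus False using assms(2) by simp
qed

lemma total_degree_le_sum:
  "(\<And>i. i \<in> I \<Longrightarrow> total_degree_le n (f i)) \<Longrightarrow> total_degree_le n (sum f I)"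
proof (induction I rule: infinite_finite_induct)
  case (insert i I)
  have *: "total_degree_le n (G + H)" if "total_degree_le n G" "total_degree_le n H" 
    for G H :: "'b poly poly"
    unfolding total_degree_le_def
  proof (intro allI impI)
    fix j assume "coeff (G + H) j \<noteq> 0"
    hence "coeff G j \<noteq> 0 \<or> coeff H j \<noteq> 0" by auto
    hence "j \<le> n" using that by (auto simp: total_degree_le_def dest!: spec[of _ j])
    have "degree (coeff G j) \<le> n - j" "degree (coeff H j) \<le> n - j"
      using that by (cases "coeff G j = 0"; cases "coeff H j = 0"; 
         auto simp: total_degree_le_def dest!: spec[of _ j])+
    hence "degree (coeff (G + H) j) \<le> n - j" by (simp add: degree_add_le)
    thus "degree (coeff (G + H) j) + j \<le> n" using \<open>j \<le> n\<close> by simp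
  qed
  show ?case using insert by (simp add: *)
qed (auto simp: total_degree_le_def)

lemma total_degree_le_mult:
  assumes "total_degree_le m G" "total_degree_le n H"
  shows "total_degree_le (m + n) (G * H)"
  unfolding total_degree_le_def
proof (intro allI impI)
  fix j assume ne: "coeff (G * H) j \<noteq> 0"
  have 1: "degree (coeff G i * coeff H (j - i)) + j \<le> m + n" 
    if "i \<le> j" "coeff G i * coeff H (j - i) \<noteq> 0" for i
  proof -
    have "degree (coeff G i) + i \<le> m" "degree (coeff H (j - i)) + (j - i) \<le> n"
      using that by (auto intro!: assms[unfolded total_degree_le_def, rule_format] simp del: add_diff_assoc)
    thus ?thesis using degree_mult_le[of "coeff G i" "coeff H (j - i)"] that by linarith
  qed
  obtain i where "i \<le> j" "coeff G i * coeff H (j - i) \<noteq> 0"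
    using ne unfolding coeff_mult by (metis (no_types, lifting) atMost_iff sum.neutral)
  hence j: "j \<le> m + n" using 1 by fastforce
  have "degree (coeff G i * coeff H (j - i)) \<le> m + n - j" if "i \<le> j" for i
    using 1[OF that] by (cases "coeff G i * coeff H (j - i) = 0") auto
  hence "degree (coeff (G * H) j) \<le> m + n - j"
    unfolding coeff_mult by (intro degree_sum_le) auto
  thus "degree (coeff (G * H) j) + j \<le> m + n" using j by simp
qed

lemma total_degree_le_power: "total_degree_le n G \<Longrightarrow> total_degree_le (k * n) (G ^ k)"
  by (induction k) (auto simp: total_degree_le_mult, simp add: total_degree_le_def coeff_1)

lemma total_degree_le_pderiv:
  assumes "total_degree_le n G"
  shows "total_degree_le (n - 1) (pderiv G)"
  unfolding total_degree_le_def
proof (intro allI impI)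
  fix j assume "coeff (pderiv G) j \<noteq> 0"
  hence "coeff G (Suc j) \<noteq> 0" by (auto simp: coeff_pderiv)
  hence "degree (coeff G (Suc j)) + Suc j \<le> n" using assms by (auto simp: total_degree_le_def)
  moreover have "degree (coeff (pderiv G) j) \<le> degree (coeff G (Suc j))"
    by (simp add: coeff_pderiv mult_of_nat_commute of_nat_poly)
  ultimately show "degree (coeff (pderiv G) j) + j \<le> n - 1" by simp
qed

text \<open>
  Each term of the Leibniz formula meets every row and every column once, so weights of
  rows and columns add up.
\<close>

lemma degree_det_le:
  fixes M :: "'a::idom poly mat" and r s :: "nat \<Rightarrow> nat"
  assumes M: "M \<in> carrier_mat n n" and ne: "det M \<noteq> 0"
    and deg: "\<And>i j. i < n \<Longrightarrow> j < n \<Longrightarrow> M $$ (i, j) \<noteq> 0 \<Longrightarrow> degree (M $$ (i, j)) + s j \<le> r i"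
  shows "degree (det M) + (\<Sum>j<n. s j) \<le> (\<Sum>i<n. r i)"
proof -
  let ?P = "{p. p permutes {0..<n}}"
  define T where "T p = signof p * (\<Prod>i = 0..<n. M $$ (i, p i))" for p
  have detT: "det M = (\<Sum>p\<in>?P. T p)" by (simp add: T_def det_def'[OF M])
  have T: "degree (T p) + (\<Sum>j<n. s j) \<le> (\<Sum>i<n. r i)" if p: "p permutes {0..<n}" "T p \<noteq> 0" for p
  proof -
    have ne: "M $$ (i, p i) \<noteq> 0" if "i < n" for i
      using p(2) that by (auto simp: T_def)
    have pn: "p i < n" if "i < n" for i using permutes_in_image[OF p(1), of i] that by simp
    have "T p = (\<Prod>i = 0..<n. M $$ (i, p i)) \<or> T p = - (\<Prod>i = 0..<n. M $$ (i, p i))"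
      by (cases p rule: sign_cases) (auto simp: T_def)
    hence "degree (T p) \<le> (\<Sum>i<n. degree (M $$ (i, p i)))"
      using degree_prod_sum_le[of "{0..<n}" "\<lambda>i. M $$ (i, p i)"] 
      by (auto simp: o_def atLeast0LessThan)
    moreover have "(\<Sum>j<n. s j) = (\<Sum>i<n. s (p i))"
      using sum.permute[OF p(1), of s] by (simp add: o_def atLeast0LessThan)
    ultimately have "degree (T p) + (\<Sum>j<n. s j) \<le> (\<Sum>i<n. degree (M $$ (i, p i)) + s (p i))"
      by (simp add: sum.distrib)
    also have "\<dots> \<le> (\<Sum>i<n. r i)" by (intro sum_mono deg ne pn) auto
    finally show ?thesis .
  qed
  obtain p where "p permutes {0..<n}" "T p \<noteq> 0"
    using ne unfolding detT by (metis (no_types, lifting) mem_Collect_eq sum.neutral)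
  hence le: "(\<Sum>j<n. s j) \<le> (\<Sum>i<n. r i)" using T by fastforce
  have "degree (T p) \<le> (\<Sum>i<n. r i) - (\<Sum>j<n. s j)" if "p permutes {0..<n}" for p
    using T[OF that] by (cases "T p = 0") auto
  hence "degree (det M) \<le> (\<Sum>i<n. r i) - (\<Sum>j<n. s j)"
    unfolding detT by (intro degree_sum_le) (auto simp: finite_permutations)
  with le show ?thesis by linarith
qed

text \<open>
  In the Sylvester matrix the row of \<open>y ^ i * f\<close> has weight \<open>a + i\<close>, the row of \<open>y ^ i * g\<close> has weight
  \<open>b + i\<close>, and the column of \<open>y ^ j\<close> has weight \<open>j\<close>.
\<close>

lemma degree_resultant_le:
  fixes f g :: "'a::idom poly poly"
  assumes f: "total_degree_le a f" and g: "total_degree_le b g" and ne: "resultant f g \<noteq> 0"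
  shows "degree (resultant f g) + degree f * degree g \<le> degree g * a + degree f * b"
proof -
  define m n where "m = degree f" and "n = degree g"
  define N where "N = m + n"
  define M where "M = sylvester_mat f g"
  define r where "r i = (if i < n then a + (n - 1 - i) else b + (N - 1 - i))" for i
  have M: "M \<in> carrier_mat N N" by (auto simp: M_def N_def m_def n_def)
  have "degree (det M) + (\<Sum>j<N. N - 1 - j) \<le> (\<Sum>i<N. r i)"
  proof (rule degree_det_le[OF M])
    show "det M \<noteq> 0" using ne by (simp add: resultant_def M_def)
    fix i j assume ij: "i < N" "j < N" and nz: "M $$ (i, j) \<noteq> 0"
    have e: "M $$ (i, j) = (if i < n then (if i \<le> j \<and> j - i \<le> m then coeff f (m + i - j) else 0)
        else if i - n \<le> j \<and> j \<le> i then coeff g (i - j) else 0)"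
      using ij unfolding M_def N_def m_def n_def by (rule sylvester_index_mat)
    show "degree (M $$ (i, j)) + (N - 1 - j) \<le> r i"
    proof (cases "i < n")
      case True
      hence *: "i \<le> j" "j - i \<le> m" "M $$ (i, j) = coeff f (m + i - j)"
        using e nz by (auto split: if_splits)
      hence "degree (M $$ (i, j)) + (m + i - j) \<le> a"
        using f nz unfolding *(3) total_degree_le_def by blast
      thus ?thesis using * True ij by (simp add: r_def N_def)
    next
      case False
      hence *: "i - n \<le> j" "j \<le> i" "M $$ (i, j) = coeff g (i - j)"
        using e nz by (auto split: if_splits)
      hence "degree (M $$ (i, j)) + (i - j) \<le> b"
        using g nz unfolding *(3) total_degree_le_def by blast
      thus ?thesis using * False ij by (simp add: r_def)
    qed
  qed
  moreover have "(\<Sum>i<N. r i) = (\<Sum>i<n. a + (n - 1 - i)) + (\<Sum>i<m. b + (m - 1 - i))"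
  proof -
    have "{..<N} = {..<n} \<union> (\<lambda>i. n + i) ` {..<m}"
      using image_add_atLeastLessThan[of n 0 m] by (auto simp: N_def lessThan_atLeast0)
    hence "(\<Sum>i<N. r i) = (\<Sum>i<n. r i) + (\<Sum>i\<in>(\<lambda>i. n + i) ` {..<m}. r i)"
      by (simp add: sum.union_disjoint[of "{..<n}"] image_iff disjoint_iff)
    also have "\<dots> = (\<Sum>i<n. r i) + (\<Sum>i<m. r (n + i))" by (simp add: sum.reindex)
    also have "\<dots> = (\<Sum>i<n. a + (n - 1 - i)) + (\<Sum>i<m. b + (m - 1 - i))"
      by (intro arg_cong2[of _ _ _ _ "(+)"] sum.cong) (auto simp: r_def N_def)
    finally show ?thesis .
  qed
  moreover have gauss: "2 * (\<Sum>i<k. k - 1 - i) + k = k * k" for k :: nat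
  proof -
    have "(\<Sum>i<k. k - 1 - i) = (\<Sum>i<k. i)"
      by (rule sum.reindex_bij_witness[of _ "\<lambda>j. k - 1 - j" "\<lambda>j. k - 1 - j"]) auto
    moreover have "2 * (\<Sum>i<k. i) + k = k * k" by (induction k) auto
    ultimately show ?thesis by simp
  qed
  ultimately have "2 * degree (det M) + (N * N) \<le> 2 * (n * a) + n * n + (2 * (m * b) + m * m)"
    using gauss[of N] gauss[of n] gauss[of m] N_def 
    unfolding sum.distrib sum_constant card_lessThan of_nat_id by linarith
  hence "degree (det M) + m * n \<le> n * a + m * b" by (simp add: N_def algebra_simps)
  thus ?thesis by (simp add: resultant_def M_def m_def n_def)
qed

text \<open>
  The discriminant of a plane curve of degree \<open>d\<close> has degree \<open>d * (d - 1)\<close> in general. The assumption that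
  the degree of \<open>G\<close> in the outer variable drops, which means that the centre of projection lies on the
  curve, saves one: with degree \<open>n\<close> the bound is \<open>(2 * n - 1) * d - n\<^sup>2\<close>, which increases up to \<open>n = d\<close>.
\<close>

lemma degree_discriminant_le:
  fixes G :: "'a::{idom,ring_char_0} poly poly"
  assumes G: "total_degree_le d G" and n: "degree G \<ge> 1" "degree G \<le> d - 1"
    and ne: "resultant G (pderiv G) \<noteq> 0"
  shows "degree (resultant G (pderiv G)) + d + 1 \<le> d * d"
proof -
  define n where "n = degree G"
  have "degree (resultant G (pderiv G)) + degree G * degree (pderiv G)
      \<le> degree (pderiv G) * d + degree G * (d - 1)"
    by (intro degree_resultant_le total_degree_le_pderiv G ne)
  hence *: "degree (resultant G (pderiv G)) + n * (n - 1) \<le> (n - 1) * d + n * (d - 1)"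
    by (simp add: degree_pderiv n_def)
  define e where "e = d - 1 - n"
  obtain k where k: "n = Suc k" using n by (cases n) (auto simp: n_def)
  have d: "d = k + 2 + e" using n k by (simp add: n_def e_def)
  show ?thesis using * unfolding k d by (simp add: algebra_simps)
qed

section \<open>Polynomials in two and three variables\<close>

abbreviation eval2 :: "complex poly poly \<Rightarrow> complex \<Rightarrow> complex \<Rightarrow> complex" where
  "eval2 G x y \<equiv> poly (poly G [:y:]) x"

text \<open>
  The restriction of a polynomial in two variables to a vertical line.
\<close>

abbreviation slice :: "complex \<Rightarrow> complex poly poly \<Rightarrow> complex poly" where
  "slice x G \<equiv> map_poly (\<lambda>c. poly c x) G"

lemma poly_slice: "poly (slice x G) y = eval2 G x y"
  by (induction G) (simp_all add: map_poly_pCons algebra_simps)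

lemma slice_mult:
  fixes G H :: "complex poly poly"
  shows "slice x (G * H) = slice x G * slice x H"
  by (simp add: poly_eq_poly_eq_iff[symmetric] fun_eq_iff poly_slice)

lemma slice_add:
  fixes G H :: "complex poly poly"
  shows "slice x (G + H) = slice x G + slice x H"
  by (simp add: poly_eq_poly_eq_iff[symmetric] fun_eq_iff poly_slice)

lemma slice_pderiv:
  fixes G :: "complex poly poly"
  shows "slice x (pderiv G) = pderiv (slice x G)"
  by (rule poly_eqI) (simp add: coeff_map_poly coeff_pderiv of_nat_poly)

lemma eval2_eq_0_imp_0:
  assumes "\<And>x y. eval2 G x y = 0"
  shows "G = 0"
proof (rule ccontr)
  assume "G \<noteq> 0"
  have "poly G [:y:] = 0" for y using assms by (metis poly_all_0_iff_0)
  hence "range (\<lambda>y::complex. [:y:]) \<subseteq> {p. poly G p = 0}" by auto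
  hence "finite (range (\<lambda>y::complex. [:y:]))"
    using poly_roots_finite[OF \<open>G \<noteq> 0\<close>] finite_subset by blast
  moreover have "inj (\<lambda>y::complex. [:y:])" by (auto intro: injI)
  ultimately show False using finite_imageD infinite_UNIV_char_0 by blast
qed

lemma eval3_eq_0_imp_0:
  assumes "\<And>v. eval3 F v = 0"
  shows "F = 0"
proof (rule ccontr)
  assume "F \<noteq> 0"
  have "eval2 (poly F [:[:z:]:]) x y = 0" for x y z
    using assms[of "vector [x, y, z]"] by (simp add: eval3_def)
  hence "poly F [:[:z:]:] = 0" for z by (rule eval2_eq_0_imp_0)
  hence "range (\<lambda>z::complex. [:[:z:]:]) \<subseteq> {p. poly F p = 0}" by auto
  hence "finite (range (\<lambda>z::complex. [:[:z:]:]))"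
    using poly_roots_finite[OF \<open>F \<noteq> 0\<close>] finite_subset by blast
  moreover have "inj (\<lambda>z::complex. [:[:z:]:])" by (auto intro: injI)
  ultimately show False using finite_imageD infinite_UNIV_char_0 by blast
qed

lemma eval3_altdef:
  "eval3 F v = (\<Sum>k\<le>degree F. \<Sum>j\<le>degree (coeff F k). \<Sum>i\<le>degree (coeff (coeff F k) j).
     coeff (coeff (coeff F k) j) i * (v $ 1) ^ i * (v $ 2) ^ j * (v $ 3) ^ k)"
  unfolding eval3_def
  by (simp add: poly_altdef[of F] poly_altdef[of "coeff F _"] poly_altdef[of "coeff (coeff F _) _"]
      poly_sum poly_power sum_distrib_right mult.assoc)

lemma eval3_scale:
  assumes "homogeneous_of_degree d F"
  shows "eval3 F (c *s v) = c ^ d * eval3 F v"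
  unfolding eval3_altdef sum_distrib_left
proof (intro sum.cong refl)
  fix k j i
  let ?a = "coeff (coeff (coeff F k) j) i"
  show "?a * ((c *s v) $ 1) ^ i * ((c *s v) $ 2) ^ j * ((c *s v) $ 3) ^ k =
        c ^ d * (?a * (v $ 1) ^ i * (v $ 2) ^ j * (v $ 3) ^ k)"
  proof (cases "?a = 0")
    case False
    hence "d = i + j + k" using assms by (auto simp: homogeneous_of_degree_def)
    thus ?thesis by (simp add: power_mult_distrib power_add)
  qed simp
qed

text \<open>
  The polynomial \<open>a + b x + c y\<close>.
\<close>

definition affine_form :: "complex \<Rightarrow> complex \<Rightarrow> complex \<Rightarrow> complex poly poly" where
  "affine_form a b c = [:[:a, b:], [:c:]:]"

text \<open>
  The pullback of \<open>F\<close> under \<open>(x, y) \<mapsto> p + x u + y w\<close>. It is written out in monomials, because bounding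
  its total degree requires the homogeneity of \<open>F\<close> monomial by monomial.
\<close>

definition chart :: "poly3 \<Rightarrow> complex^3 \<Rightarrow> complex^3 \<Rightarrow> complex^3 \<Rightarrow> complex poly poly" where
  "chart F p u w =
    (\<Sum>k\<le>degree F. \<Sum>j\<le>degree (coeff F k). \<Sum>i\<le>degree (coeff (coeff F k) j).
       [:[:coeff (coeff (coeff F k) j) i:]:] * affine_form (p $ 1) (u $ 1) (w $ 1) ^ i *
         affine_form (p $ 2) (u $ 2) (w $ 2) ^ j * affine_form (p $ 3) (u $ 3) (w $ 3) ^ k)"

lemma eval2_chart: "eval2 (chart F p u w) x y = eval3 F (p + x *s u + y *s w)"
  unfolding chart_def eval3_altdef
  by (simp add: poly_sum poly_power affine_form_def algebra_simps)

lemma total_degree_le_chart: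
  assumes "homogeneous_of_degree d F"
  shows "total_degree_le d (chart F p u w)"
  unfolding chart_def
proof (intro total_degree_le_sum)
  fix k j i
  let ?a = "coeff (coeff (coeff F k) j) i"
  have aff: "total_degree_le 1 (affine_form a b c)" for a b c
    by (auto simp: total_degree_le_def affine_form_def coeff_pCons split: nat.splits)
  have const: "total_degree_le 0 [:[:?a:]:]"
    by (auto simp: total_degree_le_def coeff_pCons split: nat.splits)
  show "total_degree_le d ([:[:?a:]:] * affine_form (p $ 1) (u $ 1) (w $ 1) ^ i *
         affine_form (p $ 2) (u $ 2) (w $ 2) ^ j * affine_form (p $ 3) (u $ 3) (w $ 3) ^ k)"
  proof (cases "?a = 0")
    case False
    hence d: "d = 0 + i * 1 + j * 1 + k * 1" using assms by (auto simp: homogeneous_of_degree_def)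
    show ?thesis unfolding d
      by (intro total_degree_le_mult const total_degree_le_power aff)
  qed (simp add: total_degree_le_def)
qed

text \<open>
  The line joining \<open>p + x u\<close> to \<open>w\<close> is parametrized both by \<open>p + x u + y w\<close> and by \<open>w + s (p + x u)\<close>.
  By homogeneity the two restrictions of \<open>F\<close> are reversed polynomials of each other, so the top
  coefficient of one is the constant coefficient of the other.
\<close>

lemma coeff_chart_degree:
  assumes F: "homogeneous_of_degree d F"
  shows "coeff (chart F p u w) d = [:eval3 F w:]"
proof -
  have "poly (coeff (chart F p u w) d) x = eval3 F w" for x
  proof -
    define P where "P = slice x (chart F p u w)"
    define Q where "Q = slice 0 (chart F w 0 (p + x *s u))"
    define P' where "P' = (\<Sum>j\<le>d. monom (coeff Q j) (d - j))"
    have P: "poly P y = eval3 F (p + x *s u + y *s w)" for y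
      by (simp add: P_def poly_slice eval2_chart)
    have Q: "poly Q y = eval3 F (w + y *s (p + x *s u))" for y
      by (simp add: Q_def poly_slice eval2_chart)
    have dQ: "degree Q \<le> d"
    proof (rule degree_le, intro allI impI)
      fix j assume "d < j"
      hence "coeff (chart F w 0 (p + x *s u)) j = 0"
        using total_degree_le_chart[OF F, of w 0 "p + x *s u"] by (force simp: total_degree_le_def)
      thus "coeff Q j = 0" by (simp add: Q_def coeff_map_poly)
    qed
    have "poly P y = poly P' y" if "y \<noteq> 0" for y
    proof -
      have "poly P y = eval3 F (y *s (w + (1 / y) *s (p + x *s u)))"
        using that unfolding P
        by (intro arg_cong[of _ _ "eval3 F"]) (simp add: vector_add_ldistrib vector_smult_assoc add_ac)
      also have "\<dots> = y ^ d * poly Q (1 / y)" by (simp only: eval3_scale[OF F] Q)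
      also have "poly Q (1 / y) = (\<Sum>j\<le>d. coeff Q j * (1 / y) ^ j)"
        unfolding poly_altdef using dQ by (intro sum.mono_neutral_left) (auto simp: coeff_eq_0)
      also have "y ^ d * \<dots> = poly P' y"
        unfolding P'_def poly_sum poly_monom sum_distrib_left
      proof (intro sum.cong refl)
        fix j assume "j \<in> {..d}"
        hence "y ^ d = y ^ (d - j) * y ^ j" by (simp flip: power_add)
        thus "y ^ d * (coeff Q j * (1 / y) ^ j) = coeff Q j * y ^ (d - j)"
          using that by (simp add: field_simps)
      qed
      finally show ?thesis .
    qed
    hence "poly ([:0, 1:] * (P - P')) y = 0" for y by (cases "y = 0") auto
    hence "[:0, 1:] * (P - P') = 0" using poly_all_0_iff_0 by blast
    hence "P = P'" by simp
    hence "coeff P d = coeff Q 0"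
      by (simp add: P'_def coeff_sum coeff_monom if_distrib cong: if_cong)
         (subst sum.cong[OF refl, of _ _ "\<lambda>j. if j = 0 then coeff Q 0 else 0"], auto)
    also have "\<dots> = eval3 F w" using Q[of 0] by (simp add: poly_0_coeff_0)
    finally show ?thesis by (simp add: P_def coeff_map_poly)
  qed
  hence "poly (coeff (chart F p u w) d) = poly [:eval3 F w:]" by auto
  thus ?thesis by (simp only: poly_eq_poly_eq_iff)
qed

section \<open>Bases of three-dimensional space\<close>

text \<open>
  The determinant with rows \<open>u\<close>, \<open>v\<close>, \<open>w\<close>, used as an explicit test for being a basis.
\<close>

definition triple :: "complex^3 \<Rightarrow> complex^3 \<Rightarrow> complex^3 \<Rightarrow> complex" where
  "triple u v w = u $ 1 * (v $ 2 * w $ 3 - v $ 3 * w $ 2) - u $ 2 * (v $ 1 * w $ 3 - v $ 3 * w $ 1)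
     + u $ 3 * (v $ 1 * w $ 2 - v $ 2 * w $ 1)"

lemma triple_cramer:
  "triple u v w *s x = triple x v w *s u + triple u x w *s v + triple u v x *s w"
  by (simp add: vec_eq_iff forall_3 triple_def algebra_simps)

lemma triple_basis:
  assumes "triple u v w \<noteq> 0"
  shows "x = (triple x v w / triple u v w) *s u + (triple u x w / triple u v w) *s v
           + (triple u v x / triple u v w) *s w"
proof -
  have "x = (1 / triple u v w) *s (triple u v w *s x)" using assms by (simp add: vector_smult_assoc)
  also have "triple u v w *s x = triple x v w *s u + triple u x w *s v + triple u v x *s w"
    by (rule triple_cramer)
  finally show ?thesis by (simp add: vector_add_ldistrib vector_smult_assoc)
qed

lemma dependent_if_triple_0:
  assumes "\<And>r. triple a b r = 0" "b \<noteq> 0"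
  obtains k where "a = k *s b"
proof -
  have t: "triple a b (vector [1, 0, 0]) = a $ 2 * b $ 3 - a $ 3 * b $ 2"
    "triple a b (vector [0, 1, 0]) = a $ 3 * b $ 1 - a $ 1 * b $ 3"
    "triple a b (vector [0, 0, 1]) = a $ 1 * b $ 2 - a $ 2 * b $ 1"
    by (simp_all add: triple_def)
  hence c: "a $ 2 * b $ 3 = a $ 3 * b $ 2" "a $ 3 * b $ 1 = a $ 1 * b $ 3" "a $ 1 * b $ 2 = a $ 2 * b $ 1"
    using assms(1) by simp_all
  obtain i where i: "b $ i \<noteq> 0" using assms(2) by (auto simp: vec_eq_iff)
  have "a $ j * b $ i = a $ i * b $ j" for j
    using c exhaust_3[of i] exhaust_3[of j] by auto
  hence "a = (a $ i / b $ i) *s b" using i by (simp add: vec_eq_iff field_simps)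
  thus ?thesis by (rule that)
qed

lemma basis_extension:
  assumes "r \<noteq> 0"
  obtains u w where "triple u w r \<noteq> 0"
proof -
  have "triple (vector [1, 0, 0]) (vector [0, 1, 0]) r = r $ 3"
    "triple (vector [0, 1, 0]) (vector [0, 0, 1]) r = r $ 1"
    "triple (vector [0, 0, 1]) (vector [1, 0, 0]) r = r $ 2"
    by (simp_all add: triple_def)
  moreover have "r $ 1 \<noteq> 0 \<or> r $ 2 \<noteq> 0 \<or> r $ 3 \<noteq> 0" using assms by (auto simp: vec_eq_iff forall_3)
  ultimately show ?thesis using that by metis
qed

section \<open>Singular points in a chart\<close>

lemma eval3_differentiable: "eval3 F differentiable (at v)"
proof -
  have "(\<lambda>v::complex^3. v $ i) differentiable (at v)" for i
    by (intro bounded_linear_imp_differentiable bounded_linear_vec_nth)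
  hence "(\<lambda>v. \<Sum>k\<le>degree F. \<Sum>j\<le>degree (coeff F k). \<Sum>i\<le>degree (coeff (coeff F k) j).
     coeff (coeff (coeff F k) j) i * (v $ 1) ^ i * (v $ 2) ^ j * (v $ 3) ^ k) differentiable (at v)"
    by (intro differentiable_sum differentiable_mult differentiable_power differentiable_const) auto
  thus ?thesis by (simp add: eval3_altdef[abs_def])
qed

lemma derivative_along_line:
  assumes L: "(eval3 F has_derivative L) (at v)" and p: "\<And>\<tau>. poly p \<tau> = eval3 F (v + \<tau> *s w)"
  shows "L w = coeff p 1"
proof -
  have "linear (\<lambda>\<tau>::complex. \<tau> *s w)"
    by (rule linearI) (simp_all add: vec_eq_iff algebra_simps)
  hence "((\<lambda>\<tau>::complex. \<tau> *s w) has_derivative (\<lambda>\<tau>. \<tau> *s w)) (at 0)"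
    by (simp add: linear_conv_bounded_linear bounded_linear_imp_has_derivative)
  hence 1: "((\<lambda>\<tau>::complex. v + \<tau> *s w) has_derivative (\<lambda>\<tau>. \<tau> *s w)) (at 0)"
    using has_derivative_add[OF has_derivative_const] by fastforce
  have "((\<lambda>\<tau>. eval3 F (v + \<tau> *s w)) has_derivative (\<lambda>\<tau>. L (\<tau> *s w))) (at 0)"
    using has_derivative_compose[OF 1, of "eval3 F" L] L by simp
  moreover have "poly p = (\<lambda>\<tau>. eval3 F (v + \<tau> *s w))" by (intro ext p)
  ultimately have "(poly p has_derivative (\<lambda>\<tau>. L (\<tau> *s w))) (at 0)" by simp
  moreover have "(poly p has_derivative (\<lambda>\<tau>. poly (pderiv p) 0 * \<tau>)) (at 0)"
    using poly_DERIV[of p 0] by (simp add: has_field_derivative_def)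
  ultimately have "(\<lambda>\<tau>. L (\<tau> *s w)) = (\<lambda>\<tau>. poly (pderiv p) 0 * \<tau>)"
    by (rule has_derivative_unique)
  from fun_cong[OF this, of 1] show ?thesis by (simp add: poly_0_coeff_0 coeff_pderiv)
qed

lemma singular_point_line:
  assumes P: "P \<in> singular_points F" and v: "v \<in> P" "v \<noteq> 0"
    and p: "\<And>\<tau>. poly p \<tau> = eval3 F (v + \<tau> *s w)"
  shows "coeff p 0 = 0" "coeff p 1 = 0"
proof -
  have "eval3 F v = 0" using P v by (auto simp: singular_points_def curve_def)
  thus "coeff p 0 = 0" using p[of 0] by (simp add: poly_0_coeff_0)
  have "(eval3 F has_derivative (\<lambda>_. 0)) (at v)" using P v by (auto simp: singular_points_def)
  from derivative_along_line[OF this p] show "coeff p 1 = 0" by simp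
qed

text \<open>
  Conversely to the preceding lemma, two directions suffice: the derivative of \<open>F\<close> at a point \<open>v\<close> is linear,
  and along \<open>v\<close> itself \<open>F\<close> vanishes identically by homogeneity. The argument is carried out at all
  nonzero multiples of \<open>v\<close>, since these are the representatives of the point.
\<close>

lemma singular_pointI:
  assumes F: "homogeneous_of_degree d F" and T: "triple v u w \<noteq> 0"
    and p: "\<And>\<tau>. poly p \<tau> = eval3 F (v + \<tau> *s u)" "coeff p 0 = 0" "coeff p 1 = 0"
    and q: "\<And>\<tau>. poly q \<tau> = eval3 F (v + \<tau> *s w)" "coeff q 1 = 0"
  shows "vec.span {v} \<in> singular_points F"
proof -
  have v: "v \<noteq> 0" using T by (auto simp: triple_def)
  have Fv: "eval3 F v = 0" using p(1)[of 0] p(2) by (simp add: poly_0_coeff_0)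
  have "eval3 F v' = 0 \<and> (eval3 F has_derivative (\<lambda>_. 0)) (at v')" 
    if v': "v' \<in> vec.span {v} - {0}" for v'
  proof
    obtain \<kappa> where \<kappa>: "v' = \<kappa> *s v" "\<kappa> \<noteq> 0" using v' by (auto simp: vec.span_singleton)
    show "eval3 F v' = 0" by (simp add: \<kappa> eval3_scale[OF F] Fv)
    obtain L where L: "(eval3 F has_derivative L) (at v')"
      using eval3_differentiable by (auto simp: differentiable_def)
    have L0: "L (c *s z) = 0" if "\<And>\<tau>. poly p \<tau> = eval3 F (v + \<tau> *s z)" "coeff p 1 = 0" for c z p
    proof -
      define p' where "p' = smult (\<kappa> ^ d) (pcompose p [:0, c / \<kappa>:])"
      have "poly p' \<tau> = eval3 F (v' + \<tau> *s (c *s z))" for \<tau>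
      proof -
        have "v' + \<tau> *s (c *s z) = \<kappa> *s (v + (c / \<kappa> * \<tau>) *s z)"
          using \<kappa> by (simp add: vector_add_ldistrib vector_smult_assoc mult.commute)
        hence "eval3 F (v' + \<tau> *s (c *s z)) = \<kappa> ^ d * poly p (c / \<kappa> * \<tau>)"
          by (simp only: eval3_scale[OF F] that)
        thus ?thesis by (simp add: p'_def poly_pcompose mult.commute)
      qed
      moreover have "coeff p' 1 = 0"
      proof -
        have "coeff p' 1 = poly (pderiv p') 0" by (simp add: poly_0_coeff_0 coeff_pderiv)
        also have "\<dots> = 0"
        proof -
          have "poly (pderiv p) 0 = 0" using that(2) by (simp add: poly_0_coeff_0 coeff_pderiv)
          thus ?thesis by (simp add: p'_def pderiv_smult pderiv_pcompose poly_pcompose)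
        qed
        finally show ?thesis .
      qed
      ultimately show ?thesis using derivative_along_line[OF L] by metis
    qed
    have "poly 0 \<tau> = eval3 F (v + \<tau> *s v)" for \<tau>
    proof -
      have "v + \<tau> *s v = (1 + \<tau>) *s v" by (simp add: vector_sadd_rdistrib)
      thus ?thesis by (simp only: eval3_scale[OF F] Fv) simp
    qed
    hence Lv: "L (c *s v) = 0" for c using L0[of 0 v] by simp
    have "L x = 0" for x
    proof -
      have lin: "linear L" using L has_derivative_bounded_linear bounded_linear.linear by blast
      show ?thesis
        by (subst triple_basis[OF T, of x])
           (simp only: linear_add[OF lin] Lv L0[OF p(1,3)] L0[OF q] add_0)
    qed
    hence "L = (\<lambda>_. 0)" by auto
    with L show "(eval3 F has_derivative (\<lambda>_. 0)) (at v')" by simp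
  qed
  thus ?thesis using v by (auto simp: singular_points_def curve_def CP2_def)
qed

text \<open>
  A polynomial in one variable of degree at most 1 with a double root is zero. So if \<open>d \<le> 1\<close>, then \<open>F\<close>
  vanishes on every line through the singular point.
\<close>

lemma degree_ge_2_if_singular:
  assumes F: "homogeneous_of_degree d F" and P: "P \<in> singular_points F"
  shows "d \<ge> 2"
proof (rule ccontr)
  assume d: "\<not> d \<ge> 2"
  obtain v where v: "v \<noteq> 0" "P = vec.span {v}" using P by (auto simp: singular_points_def curve_def CP2_def)
  hence "v \<in> P" by (simp add: vec.span_base)
  have "eval3 F x = 0" for x
  proof -
    define p where "p = slice 0 (chart F v 0 (x - v))"
    have p: "poly p t = eval3 F (v + t *s (x - v))" for t by (simp add: p_def poly_slice eval2_chart)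
    have "coeff p j = 0" for j
    proof (cases "j \<ge> 2")
      case True
      hence "coeff (chart F v 0 (x - v)) j = 0"
        using d by (intro coeff_eq_0_if_total_degree_le[OF total_degree_le_chart[OF F]]) simp
      thus ?thesis by (simp add: p_def coeff_map_poly)
    next
      case False
      hence "j = 0 \<or> j = 1" by auto
      thus ?thesis using singular_point_line[OF P \<open>v \<in> P\<close> v(1) p] by auto
    qed
    hence "p = 0" by (simp add: poly_eq_iff)
    thus ?thesis using p[of 1] by simp
  qed
  hence "F = 0" by (rule eval3_eq_0_imp_0)
  thus False using F by (simp add: homogeneous_of_degree_def)
qed

definition chart_coeff :: "poly3 \<Rightarrow> complex^3 \<Rightarrow> complex^3 \<Rightarrow> complex^3 \<Rightarrow> nat \<Rightarrow> nat \<Rightarrow> complex" where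
  "chart_coeff F v u w i j = coeff (coeff (chart F v u w) j) i"

lemma chart_coeff_singular:
  assumes P: "P \<in> singular_points F" and v: "v \<in> P" "v \<noteq> 0"
  shows "chart_coeff F v u w 0 0 = 0" "chart_coeff F v u w 1 0 = 0" "chart_coeff F v u w 0 1 = 0"
proof -
  have "poly (coeff (chart F v u w) 0) \<tau> = eval3 F (v + \<tau> *s u)" for \<tau>
    using eval2_chart[where F = F and p = v and u = u and w = w and x = \<tau> and y = 0] poly_0_coeff_0[of "chart F v u w"] by simp
  from singular_point_line[OF P v this]
  show "chart_coeff F v u w 0 0 = 0" "chart_coeff F v u w 1 0 = 0" by (simp_all add: chart_coeff_def)
  have "poly (slice 0 (chart F v u w)) \<tau> = eval3 F (v + \<tau> *s w)" for \<tau>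
    by (simp add: poly_slice eval2_chart)
  from singular_point_line(2)[OF P v this]
  show "chart_coeff F v u w 0 1 = 0" by (simp add: chart_coeff_def coeff_map_poly poly_0_coeff_0)
qed

section \<open>Lines and irreducible curves\<close>

lemma eval3_pCons: "eval3 (pCons a F) v = eval2 a (v $ 1) (v $ 2) + v $ 3 * eval3 F v"
  by (simp add: eval3_def)

lemma eval3_0: "eval3 0 v = 0" by (simp add: eval3_def)

lemma eval2_poly: "eval2 (poly F c) x y = eval3 F (vector [x, y, eval2 c x y])"
  by (induction F) (simp_all add: eval3_pCons eval3_0)

lemma irreducible_times_unit:
  fixes F L :: poly3
  assumes "irreducible F" "L dvd F" "\<not> L dvd 1"
  obtains u where "F = L * [:[:[:u:]:]:]" "u \<noteq> 0"
proof -
  obtain U where U: "F = L * U" using assms by (auto elim: dvdE)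
  hence "U dvd 1" using irreducibleD[OF assms(1)] assms(3) by auto
  then obtain u where u: "U = [:[:[:u:]:]:]" "u dvd 1" unfolding is_unit_poly_iff by blast
  have "u \<noteq> 0" using u(2) by (metis dvd_0_left zero_neq_one)
  with u(1) U show ?thesis by (intro that[of u]) simp_all
qed

text \<open>
  A form vanishing on the plane \<open>a x + b y + c z = 0\<close> is divisible by the linear form. Polynomials in three
  variables are nested, so the factor theorem is applied to the outermost variable
  that occurs in the linear form. By irreducibility the quotient is a constant, hence \<open>F\<close> has degree 1.
\<close>

lemma plane_in_irreducible_cone:
  assumes irr: "irreducible F" and F: "homogeneous_of_degree d F"
    and l: "a \<noteq> 0 \<or> b \<noteq> 0 \<or> c \<noteq> 0"
    and van: "\<And>v. a * v $ 1 + b * v $ 2 + c * v $ 3 = 0 \<Longrightarrow> eval3 F v = 0"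
  shows "d = 1"
proof -
  have hom: "i + j + k = d" if "coeff (coeff (coeff F k) j) i \<noteq> 0" for i j k
    using F that by (simp add: homogeneous_of_degree_def)
  consider "c \<noteq> 0" | "c = 0" "b \<noteq> 0" | "c = 0" "b = 0" "a \<noteq> 0" using l by blast
  thus ?thesis
  proof cases
    case 1
    define g where "g = [:[:0, -a/c:], [:-b/c:]:]"
    have "eval2 (poly F g) x y = 0" for x y
      unfolding eval2_poly using 1 by (intro van) (simp add: g_def field_simps)
    hence "poly F g = 0" by (rule eval2_eq_0_imp_0)
    hence "[:-g, 1:] dvd F" by (simp add: poly_eq_0_iff_dvd)
    moreover have "\<not> [:-g, 1:] dvd 1" by (simp add: is_unit_poly_iff)
    ultimately obtain u where u: "F = [:-g, 1:] * [:[:[:u:]:]:]" "u \<noteq> 0"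
      using irreducible_times_unit[OF irr] by metis
    hence "coeff (coeff (coeff F 1) 0) 0 \<noteq> 0" by simp
    thus ?thesis using hom by force
  next
    case 2
    define g where "g = [:0, -a/b:]"
    have "poly (coeff F k) g = 0" for k
    proof -
      have 1: "poly (poly G g) x = eval2 G x (poly g x)" for G x
        by (induction G) simp_all
      have 2: "poly (map_poly (\<lambda>G. poly (poly G g) x) H) z = eval3 H (vector [x, poly g x, z])" for H x z
        by (induction H) (simp_all add: map_poly_pCons eval3_pCons eval3_0 1)
      have "poly (map_poly (\<lambda>G. poly (poly G g) x) F) z = 0" for x z
        unfolding 2 using 2 by (intro van) (simp add: g_def field_simps \<open>b \<noteq> 0\<close> \<open>c = 0\<close>)
      hence "map_poly (\<lambda>G. poly (poly G g) x) F = 0" for x using poly_all_0_iff_0 by blast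
      hence "coeff (map_poly (\<lambda>G. poly (poly G g) x) F) k = 0" for x by simp
      hence "poly (poly (coeff F k) g) x = 0" for x by (simp add: coeff_map_poly)
      thus ?thesis using poly_all_0_iff_0 by blast
    qed
    hence "[:[:-g, 1:]:] dvd F" by (simp add: poly_eq_0_iff_dvd const_poly_dvd_iff)
    moreover have "\<not> [:[:-g, 1:]:] dvd 1" by (simp add: is_unit_poly_iff)
    ultimately obtain u where u: "F = [:[:-g, 1:]:] * [:[:[:u:]:]:]" "u \<noteq> 0"
      using irreducible_times_unit[OF irr] by metis
    hence "coeff (coeff (coeff F 0) 1) 0 \<noteq> 0" by simp
    thus ?thesis using hom by force
  next
    case 3
    have "poly (coeff (coeff F k) j) 0 = 0" for k j
    proof -
      have 1: "poly (map_poly (\<lambda>G. eval2 G 0 y) H) z = eval3 H (vector [0, y, z])" for H y z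
        by (induction H) (simp_all add: map_poly_pCons eval3_pCons eval3_0)
      have "poly (map_poly (\<lambda>G. eval2 G 0 y) F) z = 0" for y z
        unfolding 1 using 3 by (intro van) simp
      hence "map_poly (\<lambda>G. eval2 G 0 y) F = 0" for y using poly_all_0_iff_0 by blast
      hence "coeff (map_poly (\<lambda>G. eval2 G 0 y) F) k = 0" for y by simp
      hence "poly (slice 0 (coeff F k)) y = 0" for y
        by (simp add: coeff_map_poly poly_slice)
      hence "slice 0 (coeff F k) = 0" using poly_all_0_iff_0 by blast
      hence "coeff (slice 0 (coeff F k)) j = 0" by simp
      thus ?thesis by (simp add: coeff_map_poly)
    qed
    hence "[:0, 1:] dvd coeff (coeff F k) j" for k j
      using poly_eq_0_iff_dvd[of "coeff (coeff F k) j" 0] by simp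
    hence "[:[:[:0, 1:]:]:] dvd F" by (simp add: const_poly_dvd_iff)
    moreover have "\<not> [:[:[:0, 1:]:]:] dvd (1 :: poly3)" by (simp add: is_unit_poly_iff)
    ultimately obtain u where u: "F = [:[:[:0, 1:]:]:] * [:[:[:u:]:]:]" "u \<noteq> 0"
      using irreducible_times_unit[OF irr] by metis
    hence "coeff (coeff (coeff F 0) 0) 1 \<noteq> 0" by simp
    thus ?thesis using hom by force
  qed
qed

lemma line_leaves_irreducible_curve:
  assumes irr: "irreducible F" and F: "homogeneous_of_degree d F" and d: "d \<ge> 2"
    and T: "triple u v r \<noteq> 0" and v: "eval3 F v = 0"
  obtains t where "eval3 F (u + t *s v) \<noteq> 0"
proof -
  have False if van: "\<And>t. eval3 F (u + t *s v) = 0"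
  proof -
    define a b c :: complex where "a = u $ 2 * v $ 3 - u $ 3 * v $ 2" and "b = u $ 3 * v $ 1 - u $ 1 * v $ 3"
      and "c = u $ 1 * v $ 2 - u $ 2 * v $ 1"
    have tr: "triple u v x = a * x $ 1 + b * x $ 2 + c * x $ 3" for x :: "complex^3"
      by (simp add: triple_def a_def b_def c_def algebra_simps)
    have *: "eval3 F (s *s u + t *s v) = 0" for s t
    proof (cases "s = 0")
      case True
      thus ?thesis by (simp add: eval3_scale[OF F] v)
    next
      case False
      hence "s *s u + t *s v = s *s (u + (t / s) *s v)" by (simp add: vector_add_ldistrib vector_smult_assoc)
      thus ?thesis by (simp only: eval3_scale[OF F] van mult_zero_right)
    qed
    have "d = 1"
    proof (rule plane_in_irreducible_cone[OF irr F])
      show "a \<noteq> 0 \<or> b \<noteq> 0 \<or> c \<noteq> 0" using T by (auto simp: tr)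
      fix x :: "complex^3" assume "a * x $ 1 + b * x $ 2 + c * x $ 3 = 0"
      hence "triple u v x = 0" by (simp add: tr)
      hence "x = (triple x v r / triple u v r) *s u + (triple u x r / triple u v r) *s v"
        using triple_basis[OF T, of x] by simp
      also have "eval3 F \<dots> = 0" by (rule *)
      finally show "eval3 F x = 0" .
    qed
    thus False using d by simp
  qed
  thus ?thesis using that by blast
qed

section \<open>The link of a nondegenerate double point is disconnected\<close>

text \<open>
  Near the branch \<open>t = 0\<close>, points of the sphere of radius \<open>\<epsilon>\<close> are parametrized by the slope \<open>z = t / s\<close>.
  Dividing \<open>h\<close> by \<open>c s\<^sup>2\<close> turns the equation \<open>h = 0\<close> into \<open>z + O(\<epsilon>) = 0\<close>, that is, into a fixed point
  equation for a map which for small \<open>\<epsilon>\<close> sends the disc \<open>|z| \<le> 1/2\<close> into itself. The restriction to the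
  sphere makes this map merely continuous in \<open>z\<close>, not holomorphic, so Brouwer's theorem is used.
\<close>

lemma link_point_near_branch:
  fixes h :: "complex \<Rightarrow> complex \<Rightarrow> complex" and c s1 s2 t1 t2 :: complex and K \<delta> :: real
  assumes c: "c \<noteq> 0" and K: "K \<ge> 0" and \<delta>: "\<delta> > 0" and det: "s1 * t2 - s2 * t1 \<noteq> 0"
    and est: "\<And>s t. cmod s + cmod t \<le> \<delta> \<Longrightarrow> cmod (h s t - c * s * t) \<le> K * (cmod s + cmod t) ^ 3"
    and cont: "continuous_on {p. cmod (fst p) + cmod (snd p) \<le> \<delta>} (\<lambda>p. h (fst p) (snd p))"
  shows "\<exists>\<epsilon>0>0. \<forall>\<epsilon>. 0 < \<epsilon> \<and> \<epsilon> < \<epsilon>0 \<longrightarrow> (\<exists>x\<in>{x \<in> sphere 0 1.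
           h (of_real \<epsilon> * (s1 * fst x + s2 * snd x)) (of_real \<epsilon> * (t1 * fst x + t2 * snd x)) = 0}.
           cmod (t1 * fst x + t2 * snd x) < cmod (s1 * fst x + s2 * snd x))"
proof -
  define D where "D = s1 * t2 - s2 * t1"
  define M where "M = cmod s1 + cmod s2"
  have D: "D \<noteq> 0" using det by (simp add: D_def)
  have M: "M > 0" using det by (auto simp: M_def add_nonneg_eq_0_iff intro!: le_neq_trans)
  \<comment> \<open>the vector with \<open>s = 1\<close> and \<open>t = z\<close>, which \<open>x z\<close> normalizes\<close>
  define y where "y z = ((t2 - z * s2) / D, (z * s1 - t1) / D)" for z
  have sy: "s1 * fst (y z) + s2 * snd (y z) = 1" and ty: "t1 * fst (y z) + t2 * snd (y z) = z" for z
    using D by (simp_all add: y_def divide_simps) (simp_all add: D_def algebra_simps)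
  have y0: "y z \<noteq> 0" for z
  proof
    assume "y z = 0" thus False using sy[of z] by simp
  qed
  define \<rho> where "\<rho> z = 1 / norm (y z)" for z
  have \<rho>0: "\<rho> z > 0" for z using y0[of z] by (simp add: \<rho>_def)
  define x where "x z = \<rho> z *\<^sub>R y z" for z
  have nx: "norm (x z) = 1" for z using y0[of z] by (simp add: x_def \<rho>_def)
  have sx: "s1 * fst (x z) + s2 * snd (x z) = of_real (\<rho> z)" for z
  proof -
    have "s1 * fst (x z) + s2 * snd (x z) = of_real (\<rho> z) * (s1 * fst (y z) + s2 * snd (y z))"
      by (simp add: x_def scaleR_conv_of_real algebra_simps)
    thus ?thesis by (simp only: sy mult_1_right)
  qed
  have tx: "t1 * fst (x z) + t2 * snd (x z) = of_real (\<rho> z) * z" for z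
  proof -
    have "t1 * fst (x z) + t2 * snd (x z) = of_real (\<rho> z) * (t1 * fst (y z) + t2 * snd (y z))"
      by (simp add: x_def scaleR_conv_of_real algebra_simps)
    thus ?thesis by (simp only: ty)
  qed
  have \<rho>M: "\<rho> z \<le> M" for z
  proof -
    have "\<rho> z = cmod (s1 * fst (x z) + s2 * snd (x z))" using \<rho>0[of z] by (simp add: sx)
    also have "\<dots> \<le> cmod s1 * cmod (fst (x z)) + cmod s2 * cmod (snd (x z))"
      by (metis norm_mult norm_triangle_ineq)
    also have "\<dots> \<le> cmod s1 * 1 + cmod s2 * 1"
      using norm_fst_le[of "fst (x z)" "snd (x z)"] norm_snd_le[of "snd (x z)" "fst (x z)"] nx[of z]
      by (intro add_mono mult_left_mono) auto
    finally show ?thesis by (simp add: M_def)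
  qed
  have cont_\<rho>: "continuous_on S \<rho>" for S
    unfolding \<rho>_def y_def using y0 D by (intro continuous_intros) (auto simp: y_def)
  \<comment> \<open>the first bound keeps the disc inside the domain of the estimate, the second
    makes the values of the fixed point map at most \<open>1/2\<close>\<close>
  define \<epsilon>0 where "\<epsilon>0 = min (\<delta> / (2 * M)) (cmod c / (16 * (K + 1) * M))"
  show ?thesis
  proof (rule exI[of _ \<epsilon>0], intro conjI allI impI)
    show "\<epsilon>0 > 0" using \<delta> M K c by (simp add: \<epsilon>0_def)
    fix \<epsilon> :: real assume "0 < \<epsilon> \<and> \<epsilon> < \<epsilon>0"
    hence \<epsilon>: "\<epsilon> > 0" "\<epsilon> * (2 * M) < \<delta>" "\<epsilon> * (16 * (K + 1) * M) < cmod c" 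
      using M K by (auto simp: \<epsilon>0_def pos_less_divide_eq)
    define e where "e z = \<epsilon> * \<rho> z" for z
    have e0: "e z > 0" for z using \<epsilon> \<rho>0 by (simp add: e_def)
    have eM: "e z \<le> \<epsilon> * M" for z using \<epsilon> \<rho>M by (simp add: e_def)
    have small: "cmod (of_real (e z)) + cmod (of_real (e z) * z) \<le> 2 * e z" if "cmod z \<le> 1/2" for z
    proof -
      have "e z * cmod z \<le> e z * 1" using that e0[of z] by (intro mult_left_mono) auto
      thus ?thesis using e0[of z] by (simp add: norm_mult)
    qed
    have small': "cmod (of_real (e z)) + cmod (of_real (e z) * z) \<le> \<delta>" if "cmod z \<le> 1/2" for z
      using small[OF that] eM[of z] \<epsilon>(2) by simp
    define g where "g z = z - h (of_real (e z)) (of_real (e z) * z) / (c * of_real (e z) ^ 2)" for z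
    have "continuous_on (cball 0 (1/2)) g"
    proof -
      have "continuous_on (cball 0 (1/2)) (\<lambda>z. (complex_of_real (e z), of_real (e z) * z))"
        unfolding e_def by (intro continuous_intros cont_\<rho>)
      moreover have "(\<lambda>z. (complex_of_real (e z), of_real (e z) * z)) ` cball 0 (1/2) 
          \<subseteq> {p. cmod (fst p) + cmod (snd p) \<le> \<delta>}"
        using small' by auto
      ultimately have "continuous_on (cball 0 (1/2)) (\<lambda>z. h (of_real (e z)) (of_real (e z) * z))"
        using continuous_on_compose2[OF cont, of "cball 0 (1/2)" "\<lambda>z. (complex_of_real (e z), of_real (e z) * z)"]
        by simp
      moreover have "continuous_on (cball 0 (1/2)) (\<lambda>z::complex. c * of_real (e z) ^ 2)"
        unfolding e_def by (intro continuous_intros cont_\<rho>)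
      moreover have "c * of_real (e z) ^ 2 \<noteq> 0" for z using c e0[of z] by auto
      ultimately show ?thesis unfolding g_def
        by (intro continuous_on_diff continuous_on_divide continuous_on_id) auto
    qed
    moreover have "g \<in> cball 0 (1/2) \<rightarrow> cball 0 (1/2)"
    proof (rule funcsetI)
      fix z :: complex assume z: "z \<in> cball 0 (1/2)"
      let ?h = "h (of_real (e z)) (of_real (e z) * z)"
      have ne: "c * of_real (e z) ^ 2 \<noteq> 0" using c e0[of z] by auto
      have "g z = - (?h - c * of_real (e z) * (of_real (e z) * z)) / (c * of_real (e z) ^ 2)"
        using ne c e0[of z] by (simp add: g_def field_simps power2_eq_square)
      hence "cmod (g z) = cmod (?h - c * of_real (e z) * (of_real (e z) * z)) / (cmod c * e z ^ 2)"
        using e0[of z] by (simp add: norm_divide norm_mult norm_power norm_minus_commute del: of_real_mult)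
      also have "\<dots> \<le> (K * (2 * e z) ^ 3) / (cmod c * e z ^ 2)"
      proof (rule divide_right_mono)
        have "cmod (?h - c * of_real (e z) * (of_real (e z) * z)) \<le> K * (cmod (of_real (e z)) + cmod (of_real (e z) * z)) ^ 3"
          using z by (intro est small') auto
        also have "\<dots> \<le> K * (2 * e z) ^ 3"
          using small[of z] z K by (intro mult_left_mono power_mono) auto
        finally show "cmod (?h - c * of_real (e z) * (of_real (e z) * z)) \<le> K * (2 * e z) ^ 3" .
      qed (use c in auto)
      also have "\<dots> = 8 * K * e z / cmod c"
        using c e0[of z] by (simp add: field_simps power2_eq_square power3_eq_cube)
      also have "\<dots> \<le> 8 * K * (\<epsilon> * M) / cmod c"
        using eM[of z] K by (intro divide_right_mono mult_left_mono) auto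
      also have "\<dots> \<le> 1/2"
      proof -
        have "\<epsilon> * (16 * K * M) \<le> \<epsilon> * (16 * (K + 1) * M)"
          using \<epsilon> M by (intro mult_left_mono mult_right_mono) auto
        hence "16 * K * (\<epsilon> * M) \<le> cmod c" using \<epsilon>(3) by (simp add: mult_ac)
        thus ?thesis using c by (simp add: divide_simps)
      qed
      finally show "g z \<in> cball 0 (1/2)" by simp
    qed
    ultimately obtain z where z: "z \<in> cball 0 (1/2)" "g z = z"
      using brouwer_ball[of "1/2" 0 g] by auto
    have "h (of_real (e z)) (of_real (e z) * z) = 0"
      using z(2) c e0[of z] by (auto simp: g_def)
    moreover have "cmod (of_real (\<rho> z) * z) < cmod (of_real (\<rho> z))"
      using z(1) \<rho>0[of z] by (simp add: norm_mult)
    ultimately show "\<exists>x\<in>{x \<in> sphere 0 1.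
           h (of_real \<epsilon> * (s1 * fst x + s2 * snd x)) (of_real \<epsilon> * (t1 * fst x + t2 * snd x)) = 0}.
           cmod (t1 * fst x + t2 * snd x) < cmod (s1 * fst x + s2 * snd x)"
      using nx[of z] by (intro bexI[of _ "x z"]) (auto simp: sx tx e_def mult.assoc)
  qed
qed

text \<open>
  Points with \<open>|s| = |t|\<close> cannot lie on the link when \<open>\<epsilon>\<close> is small, since there the quadratic term \<open>c s t\<close>
  dominates the cubic error. Thus \<open>|t| < |s|\<close> and \<open>|s| < |t|\<close> separate the link, and both parts
  are nonempty by the preceding lemma.
\<close>

lemma node_link_disconnected:
  fixes h :: "complex \<Rightarrow> complex \<Rightarrow> complex" and c s1 s2 t1 t2 :: complex and K \<delta> :: real
  assumes c: "c \<noteq> 0" and K: "K \<ge> 0" and \<delta>: "\<delta> > 0" and det: "s1 * t2 - s2 * t1 \<noteq> 0"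
    and est: "\<And>s t. cmod s + cmod t \<le> \<delta> \<Longrightarrow> cmod (h s t - c * s * t) \<le> K * (cmod s + cmod t) ^ 3"
    and cont: "continuous_on {p. cmod (fst p) + cmod (snd p) \<le> \<delta>} (\<lambda>p. h (fst p) (snd p))"
  shows "\<exists>\<epsilon>0>0. \<forall>\<epsilon>. 0 < \<epsilon> \<and> \<epsilon> < \<epsilon>0 \<longrightarrow> \<not> connected {x \<in> sphere 0 1.
           h (of_real \<epsilon> * (s1 * fst x + s2 * snd x)) (of_real \<epsilon> * (t1 * fst x + t2 * snd x)) = 0}"
proof -
  define s where "s x = s1 * fst x + s2 * snd x" for x :: "complex \<times> complex"
  define t where "t x = t1 * fst x + t2 * snd x" for x :: "complex \<times> complex"
  define Z where "Z \<epsilon> = {x \<in> sphere 0 1. h (of_real \<epsilon> * s x) (of_real \<epsilon> * t x) = 0}" for \<epsilon>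
  define M where "M = cmod s1 + cmod s2"
  have M: "M > 0" using det by (auto simp: M_def add_nonneg_eq_0_iff intro!: le_neq_trans)
  have sM: "cmod (s x) \<le> M" if "norm x = 1" for x
  proof -
    have "cmod (s x) \<le> cmod s1 * cmod (fst x) + cmod s2 * cmod (snd x)"
      unfolding s_def by (metis norm_mult norm_triangle_ineq)
    also have "\<dots> \<le> cmod s1 * 1 + cmod s2 * 1"
      using norm_fst_le[of "fst x" "snd x"] norm_snd_le[of "snd x" "fst x"] that
      by (intro add_mono mult_left_mono) auto
    finally show ?thesis by (simp add: M_def)
  qed
  have st0: "s x \<noteq> 0 \<or> t x \<noteq> 0" if "norm x = 1" for x
  proof (rule ccontr)
    assume "\<not> (s x \<noteq> 0 \<or> t x \<noteq> 0)"
    hence "s x = 0" "t x = 0" by auto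
    hence st: "s1 * fst x + s2 * snd x = 0" "t1 * fst x + t2 * snd x = 0" by (auto simp: s_def t_def)
    have "(s1 * t2 - s2 * t1) * fst x = t2 * (s1 * fst x + s2 * snd x) - s2 * (t1 * fst x + t2 * snd x)"
      "(s1 * t2 - s2 * t1) * snd x = s1 * (t1 * fst x + t2 * snd x) - t1 * (s1 * fst x + s2 * snd x)"
      by (simp_all add: algebra_simps)
    hence "(s1 * t2 - s2 * t1) * fst x = 0" "(s1 * t2 - s2 * t1) * snd x = 0" by (simp_all only: st) simp_all
    hence "x = 0" using det by (simp add: prod_eq_iff)
    thus False using that by simp
  qed
  have "\<exists>\<epsilon>0>0. \<forall>\<epsilon>. 0 < \<epsilon> \<and> \<epsilon> < \<epsilon>0 \<longrightarrow> (\<exists>x\<in>Z \<epsilon>. cmod (t x) < cmod (s x))"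
    unfolding Z_def s_def t_def by (rule link_point_near_branch[OF c K \<delta> det est cont])
  then obtain \<epsilon>1 where \<epsilon>1: "\<epsilon>1 > 0" "\<And>\<epsilon>. 0 < \<epsilon> \<Longrightarrow> \<epsilon> < \<epsilon>1 \<Longrightarrow> \<exists>x\<in>Z \<epsilon>. cmod (t x) < cmod (s x)"
    by blast
  have "\<exists>\<epsilon>0>0. \<forall>\<epsilon>. 0 < \<epsilon> \<and> \<epsilon> < \<epsilon>0 \<longrightarrow> (\<exists>x\<in>Z \<epsilon>. cmod (s x) < cmod (t x))"
  proof -
    have 1: "t1 * s2 - t2 * s1 \<noteq> 0" using det by (simp add: mult.commute)
    have 2: "cmod (h t s - c * s * t) \<le> K * (cmod s + cmod t) ^ 3" if "cmod s + cmod t \<le> \<delta>" for s t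
      using est[of t s] that by (simp add: add.commute mult_ac)
    have "continuous_on {p. cmod (fst p) + cmod (snd p) \<le> \<delta>} 
        ((\<lambda>p. h (fst p) (snd p)) \<circ> (\<lambda>p. (snd p, fst p)))"
      by (rule continuous_on_compose) 
         (auto intro!: continuous_intros continuous_on_subset[OF cont] simp: add.commute)
    hence 3: "continuous_on {p. cmod (fst p) + cmod (snd p) \<le> \<delta>} (\<lambda>p. h (snd p) (fst p))"
      by (simp add: o_def)
    show ?thesis
      using link_point_near_branch[where h = "\<lambda>s t. h t s", OF c K \<delta> 1 2 3]
      unfolding Z_def s_def t_def by simp
  qed
  then obtain \<epsilon>2 where \<epsilon>2: "\<epsilon>2 > 0" "\<And>\<epsilon>. 0 < \<epsilon> \<Longrightarrow> \<epsilon> < \<epsilon>2 \<Longrightarrow> \<exists>x\<in>Z \<epsilon>. cmod (s x) < cmod (t x)"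
    by blast
  define \<epsilon>0 where "\<epsilon>0 = min (min \<epsilon>1 \<epsilon>2) (min (\<delta> / (2 * M)) (cmod c / (8 * (K + 1) * M)))"
  have "\<not> connected (Z \<epsilon>)" if "0 < \<epsilon>" "\<epsilon> < \<epsilon>0" for \<epsilon>
  proof
    assume con: "connected (Z \<epsilon>)"
    have \<epsilon>: "\<epsilon> > 0" "\<epsilon> < \<epsilon>1" "\<epsilon> < \<epsilon>2" "\<epsilon> * (2 * M) < \<delta>" "\<epsilon> * (8 * (K + 1) * M) < cmod c" 
      using M K that by (auto simp: \<epsilon>0_def pos_less_divide_eq)
    define U where "U = {x. cmod (t x) < cmod (s x)}"
    define V where "V = {x. cmod (s x) < cmod (t x)}"
    have "open U" "open V" unfolding U_def V_def s_def t_def 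
      by (intro open_Collect_less continuous_intros)+
    moreover have "U \<inter> V \<inter> Z \<epsilon> = {}" by (auto simp: U_def V_def)
    moreover have "U \<inter> Z \<epsilon> \<noteq> {}" "V \<inter> Z \<epsilon> \<noteq> {}"
      using \<epsilon>1(2)[OF \<epsilon>(1,2)] \<epsilon>2(2)[OF \<epsilon>(1,3)] by (auto simp: U_def V_def)
    moreover have "Z \<epsilon> \<subseteq> U \<union> V"
    proof
      fix x assume x: "x \<in> Z \<epsilon>"
      hence nx: "norm x = 1" and hx: "h (of_real \<epsilon> * s x) (of_real \<epsilon> * t x) = 0" by (auto simp: Z_def)
      show "x \<in> U \<union> V"
      proof (rule ccontr)
        assume "x \<notin> U \<union> V"
        hence eq: "cmod (t x) = cmod (s x)" by (auto simp: U_def V_def)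
        define r where "r = \<epsilon> * cmod (s x)"
        have "s x \<noteq> 0" using st0[OF nx] eq by auto
        hence r0: "r > 0" using \<epsilon>(1) by (simp add: r_def)
        have rM: "r \<le> \<epsilon> * M" using sM[OF nx] \<epsilon> by (simp add: r_def)
        have n: "cmod (of_real \<epsilon> * s x) = r" "cmod (of_real \<epsilon> * t x) = r" 
          using \<epsilon> by (simp_all add: norm_mult r_def eq)
        have "cmod (0 - c * (of_real \<epsilon> * s x) * (of_real \<epsilon> * t x)) \<le> K * (r + r) ^ 3"
          using est[of "of_real \<epsilon> * s x" "of_real \<epsilon> * t x"] rM \<epsilon> unfolding n hx by simp
        hence "cmod c * r * r \<le> K * (r + r) ^ 3"
          using n by (simp add: norm_mult)
        hence "cmod c * r\<^sup>2 \<le> (8 * K * r) * r\<^sup>2" by (simp add: power3_eq_cube power2_eq_square algebra_simps)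
        hence "cmod c \<le> 8 * K * r" using r0 by simp
        also have "\<dots> \<le> 8 * K * (\<epsilon> * M)" using rM K by (intro mult_left_mono) auto
        also have "\<dots> \<le> \<epsilon> * (8 * (K + 1) * M)"
          using \<epsilon> M by (simp add: algebra_simps)
        finally show False using \<epsilon> by simp
      qed
    qed
    ultimately show False using con unfolding connected_def by blast
  qed
  moreover have "\<epsilon>0 > 0" using \<epsilon>1 \<epsilon>2 \<delta> M K c by (simp add: \<epsilon>0_def)
  ultimately show ?thesis unfolding Z_def s_def t_def by blast
qed

lemma continuous_on_eval2:
  "continuous_on S (\<lambda>p. eval2 G (fst p) (snd p))"
proof (induction G)
  case (pCons a G)
  have "continuous_on S (\<lambda>p. poly a (fst p) + snd p * eval2 G (fst p) (snd p))"
    by (intro continuous_intros pCons)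
  thus ?case by simp
qed simp

lemma eval2_quadratic_remainder:
  fixes G :: "complex poly poly"
  defines "c \<equiv> \<lambda>i j. coeff (coeff G j) i"
  assumes c: "c 0 0 = 0" "c 1 0 = 0" "c 0 1 = 0"
  obtains K where "K \<ge> 0" and "\<And>x y. cmod x + cmod y \<le> 1 \<Longrightarrow>
    cmod (eval2 G x y - (c 2 0 * x\<^sup>2 + c 1 1 * x * y + c 0 2 * y\<^sup>2)) \<le> K * (cmod x + cmod y) ^ 3"
proof -
  obtain g0 g1 g2 r where G: "G = pCons g0 (pCons g1 (pCons g2 r))" by (metis pCons_cases)
  obtain a0 a1 a2 p where g0: "g0 = pCons a0 (pCons a1 (pCons a2 p))" by (metis pCons_cases)
  obtain b0 b1 q where g1: "g1 = pCons b0 (pCons b1 q)" by (metis pCons_cases)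
  obtain e0 s where g2: "g2 = pCons e0 s" by (metis pCons_cases)
  have c': "a0 = 0" "a1 = 0" "b0 = 0" "c 2 0 = a2" "c 1 1 = b1" "c 0 2 = e0"
    using c by (simp_all add: c_def G g0 g1 g2 numeral_2_eq_2)
  have bound: "\<exists>B\<ge>0. \<forall>x y. cmod x + cmod y \<le> 1 \<longrightarrow> cmod (eval2 H x y) \<le> B" for H
  proof -
    have "compact ((\<lambda>z. eval2 H (fst z) (snd z)) ` (cball 0 1 \<times> cball 0 1))"
      by (intro compact_continuous_image continuous_on_eval2 compact_Times compact_cball)
    then obtain B where B: "\<And>z. z \<in> cball 0 1 \<times> cball 0 1 \<Longrightarrow> cmod (eval2 H (fst z) (snd z)) \<le> B"
      by (force dest: compact_imp_bounded simp: bounded_iff)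
    have "cmod (eval2 H x y) \<le> \<bar>B\<bar>" if "cmod x + cmod y \<le> 1" for x y
    proof -
      have "cmod x \<le> 1" "cmod y \<le> 1" 
        using that norm_ge_zero[of x] norm_ge_zero[of y] by linarith+
      thus ?thesis using B[of "(x, y)"] by simp
    qed
    thus ?thesis by (intro exI[of _ "\<bar>B\<bar>"]) auto
  qed
  obtain K0 where K0: "K0 \<ge> 0" "\<And>x y. cmod x + cmod y \<le> 1 \<Longrightarrow> cmod (poly p x) \<le> K0"
    using bound[of "[:p:]"] by auto
  obtain K1 where K1: "K1 \<ge> 0" "\<And>x y. cmod x + cmod y \<le> 1 \<Longrightarrow> cmod (poly q x) \<le> K1"
    using bound[of "[:q:]"] by auto
  obtain K2 where K2: "K2 \<ge> 0" "\<And>x y. cmod x + cmod y \<le> 1 \<Longrightarrow> cmod (poly s x) \<le> K2"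
    using bound[of "[:s:]"] by auto
  obtain K3 where K3: "K3 \<ge> 0" "\<And>x y. cmod x + cmod y \<le> 1 \<Longrightarrow> cmod (eval2 r x y) \<le> K3"
    using bound[of r] by auto
  show ?thesis
  proof (rule that[of "K0 + K1 + K2 + K3"])
    fix x y assume xy: "cmod x + cmod y \<le> 1"
    define \<rho> where "\<rho> = cmod x + cmod y"
    have \<rho>: "cmod x \<le> \<rho>" "cmod y \<le> \<rho>" by (simp_all add: \<rho>_def)
    have cube: "cmod (u * v * w * z) \<le> K * \<rho> ^ 3"
      if "cmod u \<le> \<rho>" "cmod v \<le> \<rho>" "cmod w \<le> \<rho>" "cmod z \<le> K" "0 \<le> K" for u v w z K
    proof -
      have "cmod (u * v * w * z) \<le> \<rho> * \<rho> * \<rho> * K"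
        unfolding norm_mult using that
        by (intro mult_mono mult_nonneg_nonneg) (auto simp: \<rho>_def)
      thus ?thesis by (simp add: power3_eq_cube mult_ac)
    qed
    have "eval2 G x y - (c 2 0 * x\<^sup>2 + c 1 1 * x * y + c 0 2 * y\<^sup>2) =
      x * x * x * poly p x + x * x * y * poly q x + x * y * y * poly s x + y * y * y * eval2 r x y"
      by (simp add: c'[unfolded One_nat_def] G g0 g1 g2 power2_eq_square algebra_simps)
    also have "cmod \<dots> \<le> K0 * \<rho> ^ 3 + K1 * \<rho> ^ 3 + K2 * \<rho> ^ 3 + K3 * \<rho> ^ 3"
      by (intro norm_triangle_le add_mono cube \<rho> K0(1) K1(1) K2(1) K3(1) K0(2)[OF xy] K1(2)[OF xy]
          K2(2)[OF xy] K3(2)[OF xy])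
    finally show "cmod (eval2 G x y - (c 2 0 * x\<^sup>2 + c 1 1 * x * y + c 0 2 * y\<^sup>2))
        \<le> (K0 + K1 + K2 + K3) * (cmod x + cmod y) ^ 3"
      by (simp add: \<rho>_def algebra_simps)
  qed (use K0 K1 K2 K3 in simp)
qed

lemma binary_quadratic_form_zeros:
  fixes p q r :: complex
  assumes "q\<^sup>2 \<noteq> 4 * p * r"
  obtains a1 b1 a2 b2 where "a1 * b2 - a2 * b1 \<noteq> 0"
    "p * a1\<^sup>2 + q * a1 * b1 + r * b1\<^sup>2 = 0" "p * a2\<^sup>2 + q * a2 * b2 + r * b2\<^sup>2 = 0"
proof (cases "r = 0")
  case True
  thus ?thesis using assms that[of 0 "-p" q 1] by (auto simp: power2_eq_square algebra_simps)
next
  case False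
  define s where "s = csqrt (q\<^sup>2 - 4 * p * r)"
  have s: "s * s = q * q - 4 * p * r" by (simp add: s_def flip: power2_eq_square)
  have "s \<noteq> 0" using assms by (auto simp: s_def)
  have *: "p * (2 * r)\<^sup>2 + q * (2 * r) * (- q + t) + r * (- q + t)\<^sup>2 = 0" 
    if "t * t = q * q - 4 * p * r" for t
  proof -
    have "p * (2 * r)\<^sup>2 + q * (2 * r) * (- q + t) + r * (- q + t)\<^sup>2 = r * (t * t - (q * q - 4 * p * r))"
      by (simp add: power2_eq_square algebra_simps)
    thus ?thesis using that by simp
  qed
  show ?thesis
  proof (rule that[of "2 * r" "- q + (- s)" "2 * r" "- q + s"])
    show "2 * r * (- q + (- s)) - 2 * r * (- q + s) \<noteq> 0"
      using False \<open>s \<noteq> 0\<close> by (simp add: algebra_simps)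
  qed (intro *; simp add: s)+
qed

lemma local_equation_altdef:
  "local_equation F A z = eval3 F (column 1 A + fst z *s column 2 A + snd z *s column 3 A)"
proof -
  have "A *v vector [1, fst z, snd z] = column 1 A + fst z *s column 2 A + snd z *s column 3 A"
    by (simp add: vec_eq_iff matrix_vector_mult_def sum_3 column_def mult.commute)
  thus ?thesis by (simp add: local_equation_def split_beta)
qed

lemma triple_columns: "triple (column 1 A) (column 2 A) (column 3 A) = Determinants.det A"
  by (simp add: triple_def det_3 column_def algebra_simps)

text \<open>
  The chart \<open>A\<close> of the link and the chart given by \<open>v\<close>, \<open>u\<close>, \<open>w\<close> are centred at the same point,
  but they are different. Choose \<open>w1\<close>, \<open>w2\<close> such that the quadratic part along \<open>s w1 + t w2\<close> is \<open>e s t\<close>.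
  In the basis \<open>v\<close>, \<open>w1\<close>, \<open>w2\<close> a point of the chart \<open>A\<close> is \<open>\<mu> v + s w1 + t w2\<close>, where \<open>s\<close> and \<open>t\<close> are linear
  and \<open>\<mu>\<close> is affine in the coordinates of the chart, with \<open>\<mu> \<noteq> 0\<close> near the centre. By homogeneity
  the local equation vanishes there iff \<open>h = \<mu>\<^sup>2 h0(s/\<mu>, t/\<mu>)\<close> does, where \<open>h0(s, t) = F(v + s w1 + t w2)\<close>.
  The factor \<open>\<mu>\<^sup>2\<close> restores the quadratic part \<open>e s t\<close>.
\<close>

lemma node_chart_disconnected:
  assumes F: "homogeneous_of_degree d F"
    and P: "P \<in> singular_points F" and v: "v \<in> P" "v \<noteq> 0" and T: "triple v u w \<noteq> 0"
    and nondeg: "chart_coeff F v u w 1 1 ^ 2 \<noteq> 4 * chart_coeff F v u w 2 0 * chart_coeff F v u w 0 2"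
    and A: "invertible A" "column 1 A \<in> P"
  shows "\<exists>\<epsilon>0>0. \<forall>\<epsilon>. 0 < \<epsilon> \<and> \<epsilon> < \<epsilon>0 \<longrightarrow>
    \<not> connected {x \<in> sphere 0 1. local_equation F A (\<epsilon> *\<^sub>R x) = 0}"
proof -
  define G where "G = chart F v u w"
  define c where "c = chart_coeff F v u w"
  have c0: "c 0 0 = 0" "c 1 0 = 0" "c 0 1 = 0"
    unfolding c_def by (rule chart_coeff_singular[OF P v])+
  obtain K0 where K0: "K0 \<ge> 0" "\<And>x y. cmod x + cmod y \<le> 1 \<Longrightarrow>
    cmod (eval2 G x y - (c 2 0 * x\<^sup>2 + c 1 1 * x * y + c 0 2 * y\<^sup>2)) \<le> K0 * (cmod x + cmod y) ^ 3"
    using eval2_quadratic_remainder[of G] c0 unfolding c_def chart_coeff_def G_def by metis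
  obtain \<alpha>1 \<beta>1 \<alpha>2 \<beta>2 where D: "\<alpha>1 * \<beta>2 - \<alpha>2 * \<beta>1 \<noteq> 0"
    and Q: "c 2 0 * \<alpha>1\<^sup>2 + c 1 1 * \<alpha>1 * \<beta>1 + c 0 2 * \<beta>1\<^sup>2 = 0"
           "c 2 0 * \<alpha>2\<^sup>2 + c 1 1 * \<alpha>2 * \<beta>2 + c 0 2 * \<beta>2\<^sup>2 = 0"
    using binary_quadratic_form_zeros nondeg unfolding c_def by metis
  \<comment> \<open>in the coordinates of the two zeros the quadratic form is \<open>e s t\<close>\<close>
  define e where "e = 2 * c 2 0 * \<alpha>1 * \<alpha>2 + c 1 1 * (\<alpha>1 * \<beta>2 + \<alpha>2 * \<beta>1) + 2 * c 0 2 * \<beta>1 * \<beta>2"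
  have form: "c 2 0 * (s * \<alpha>1 + t * \<alpha>2)\<^sup>2 + c 1 1 * (s * \<alpha>1 + t * \<alpha>2) * (s * \<beta>1 + t * \<beta>2)
      + c 0 2 * (s * \<beta>1 + t * \<beta>2)\<^sup>2 = e * s * t" for s t
  proof -
    have "c 2 0 * (s * \<alpha>1 + t * \<alpha>2)\<^sup>2 + c 1 1 * (s * \<alpha>1 + t * \<alpha>2) * (s * \<beta>1 + t * \<beta>2)
        + c 0 2 * (s * \<beta>1 + t * \<beta>2)\<^sup>2 =
      s * s * (c 2 0 * \<alpha>1\<^sup>2 + c 1 1 * \<alpha>1 * \<beta>1 + c 0 2 * \<beta>1\<^sup>2) +
      t * t * (c 2 0 * \<alpha>2\<^sup>2 + c 1 1 * \<alpha>2 * \<beta>2 + c 0 2 * \<beta>2\<^sup>2) + e * s * t"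
      by (simp add: e_def power2_eq_square algebra_simps)
    thus ?thesis by (simp only: Q mult_zero_right add_0)
  qed
  \<comment> \<open>a linear substitution multiplies the discriminant of a quadratic form by the square of
    the determinant\<close>
  have "e\<^sup>2 = (\<alpha>1 * \<beta>2 - \<alpha>2 * \<beta>1)\<^sup>2 * ((c 1 1)\<^sup>2 - 4 * c 2 0 * c 0 2)
      + 4 * (c 2 0 * \<alpha>1\<^sup>2 + c 1 1 * \<alpha>1 * \<beta>1 + c 0 2 * \<beta>1\<^sup>2)
          * (c 2 0 * \<alpha>2\<^sup>2 + c 1 1 * \<alpha>2 * \<beta>2 + c 0 2 * \<beta>2\<^sup>2)"
    by (simp add: e_def power2_eq_square algebra_simps)
  hence "e\<^sup>2 = (\<alpha>1 * \<beta>2 - \<alpha>2 * \<beta>1)\<^sup>2 * ((c 1 1)\<^sup>2 - 4 * c 2 0 * c 0 2)"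
    by (simp only: Q mult_zero_right add_0_right)
  moreover have "(c 1 1)\<^sup>2 - 4 * c 2 0 * c 0 2 \<noteq> 0" using nondeg by (simp add: c_def)
  ultimately have e: "e \<noteq> 0" using D by auto
  define M where "M = 1 + cmod \<alpha>1 + cmod \<alpha>2 + cmod \<beta>1 + cmod \<beta>2"
  have M: "M \<ge> 1" by (simp add: M_def)
  define h0 where "h0 s t = eval2 G (s * \<alpha>1 + t * \<alpha>2) (s * \<beta>1 + t * \<beta>2)" for s t
  define w1 w2 where "w1 = \<alpha>1 *s u + \<beta>1 *s w" and "w2 = \<alpha>2 *s u + \<beta>2 *s w"
  have h0_eq: "h0 s t = eval3 F (v + s *s w1 + t *s w2)" for s t
    unfolding h0_def G_def eval2_chart
    by (rule arg_cong[of _ _ "eval3 F"]) (simp add: w1_def w2_def vec_eq_iff algebra_simps)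
  have h0: "cmod (h0 s t - e * s * t) \<le> K0 * M ^ 3 * (cmod s + cmod t) ^ 3" if "M * (cmod s + cmod t) \<le> 1" for s t
  proof -
    have 1: "cmod (s * \<alpha>1 + t * \<alpha>2) + cmod (s * \<beta>1 + t * \<beta>2) \<le> M * (cmod s + cmod t)"
    proof -
      have "cmod (s * \<alpha>1 + t * \<alpha>2) + cmod (s * \<beta>1 + t * \<beta>2)
          \<le> (cmod s * cmod \<alpha>1 + cmod t * cmod \<alpha>2) + (cmod s * cmod \<beta>1 + cmod t * cmod \<beta>2)"
        by (intro add_mono) (metis norm_mult norm_triangle_ineq)+
      also have "\<dots> \<le> M * (cmod s + cmod t)"
        by (simp add: M_def algebra_simps)
      finally show ?thesis .
    qed
    have "cmod (h0 s t - e * s * t) \<le> K0 * (cmod (s * \<alpha>1 + t * \<alpha>2) + cmod (s * \<beta>1 + t * \<beta>2)) ^ 3"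
      unfolding h0_def form[symmetric] using 1 that by (intro K0(2)) simp
    also have "\<dots> \<le> K0 * (M * (cmod s + cmod t)) ^ 3"
      using 1 K0(1) by (intro mult_left_mono power_mono) auto
    finally show ?thesis by (simp add: power_mult_distrib mult.assoc)
  qed
  \<comment> \<open>the chart \<open>A\<close> in the basis \<open>v, w1, w2\<close>\<close>
  define T' where "T' = triple v w1 w2"
  have "T' = (\<alpha>1 * \<beta>2 - \<alpha>2 * \<beta>1) * triple v u w"
    by (simp add: T'_def w1_def w2_def triple_def algebra_simps)
  hence T': "T' \<noteq> 0" using D T by simp
  obtain \<kappa> where \<kappa>: "column 1 A = \<kappa> *s v"
  proof -
    obtain v0 where v0: "P = vec.span {v0}" using P by (auto simp: singular_points_def curve_def CP2_def)
    obtain k l where "v = k *s v0" "column 1 A = l *s v0" using v A v0 by (auto simp: vec.span_singleton)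
    hence "column 1 A = (l / k) *s v" using v by (auto simp: vector_smult_assoc)
    thus ?thesis using that by blast
  qed
  obtain m1 s1 t1 where a2: "column 2 A = m1 *s v + s1 *s w1 + t1 *s w2"
    using triple_basis[OF T'[unfolded T'_def]] by blast
  obtain m2 s2 t2 where a3: "column 3 A = m2 *s v + s2 *s w1 + t2 *s w2"
    using triple_basis[OF T'[unfolded T'_def]] by blast
  define \<Delta> where "\<Delta> = s1 * t2 - s2 * t1"
  have "Determinants.det A = \<kappa> * \<Delta> * T'"
    unfolding triple_columns[symmetric] \<kappa> a2 a3 T'_def \<Delta>_def
    by (simp add: triple_def algebra_simps)
  hence \<kappa>0: "\<kappa> \<noteq> 0" and \<Delta>: "\<Delta> \<noteq> 0" using A(1) by (auto simp: invertible_det_nz)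
  \<comment> \<open>the coefficient of \<open>v\<close>, expressed by \<open>s\<close> and \<open>t\<close> instead of the coordinates of the chart\<close>
  define n1 n2 where "n1 = (m1 * t2 - m2 * t1) / \<Delta>" and "n2 = (m2 * s1 - m1 * s2) / \<Delta>"
  define \<mu> where "\<mu> s t = \<kappa> + n1 * s + n2 * t" for s t
  define h where "h s t = \<mu> s t ^ 2 * h0 (s / \<mu> s t) (t / \<mu> s t)" for s t
  define N where "N = 1 + cmod n1 + cmod n2"
  have N: "N \<ge> 1" by (simp add: N_def)
  \<comment> \<open>the first bound gives \<open>|\<mu>| \<ge> |\<kappa>| / 2\<close>, the second keeps \<open>(s/\<mu>, t/\<mu>)\<close> inside the domain of
    the estimate for \<open>h0\<close>\<close>
  define \<delta> where "\<delta> = min (cmod \<kappa> / (2 * N)) (cmod \<kappa> / (2 * M))"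
  have \<delta>: "\<delta> > 0" using \<kappa>0 N M by (simp add: \<delta>_def)
  have \<mu>: "cmod (\<mu> s t) \<ge> cmod \<kappa> / 2" if "cmod s + cmod t \<le> \<delta>" for s t
  proof -
    have "cmod (n1 * s + n2 * t) \<le> cmod n1 * cmod s + cmod n2 * cmod t"
      by (metis norm_mult norm_triangle_ineq)
    also have "\<dots> \<le> N * (cmod s + cmod t)" by (simp add: N_def algebra_simps)
    also have "\<dots> \<le> N * (cmod \<kappa> / (2 * N))" using that N by (intro mult_left_mono) (auto simp: \<delta>_def)
    also have "\<dots> = cmod \<kappa> / 2" using N by simp
    finally show ?thesis using norm_diff_ineq[of \<kappa> "n1 * s + n2 * t"] by (simp add: \<mu>_def add.assoc)
  qed
  have \<mu>0: "\<mu> s t \<noteq> 0" if "cmod s + cmod t \<le> \<delta>" for s t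
    using \<mu>[OF that] \<kappa>0 by auto
  define K where "K = 2 * (K0 * M ^ 3) / cmod \<kappa>"
  have K: "K \<ge> 0" using K0(1) M by (simp add: K_def)
  have est: "cmod (h s t - e * s * t) \<le> K * (cmod s + cmod t) ^ 3" if st: "cmod s + cmod t \<le> \<delta>" for s t
  proof -
    let ?m = "\<mu> s t"
    note m0 = \<mu>0[OF st]
    have eq: "cmod (s / ?m) + cmod (t / ?m) = (cmod s + cmod t) / cmod ?m"
      by (simp add: norm_divide add_divide_distrib)
    have "M * (cmod s + cmod t) \<le> M * (cmod \<kappa> / (2 * M))" 
      using st M by (intro mult_left_mono) (auto simp: \<delta>_def)
    also have "\<dots> \<le> cmod ?m" using \<mu>[OF st] M by simp
    finally have "M * (cmod (s / ?m) + cmod (t / ?m)) \<le> 1" using m0 by (simp add: eq divide_simps)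
    hence "cmod (h0 (s / ?m) (t / ?m) - e * (s / ?m) * (t / ?m))
        \<le> K0 * M ^ 3 * ((cmod s + cmod t) / cmod ?m) ^ 3"
      using h0 unfolding eq[symmetric] by blast
    hence "cmod ?m ^ 2 * cmod (h0 (s / ?m) (t / ?m) - e * (s / ?m) * (t / ?m))
        \<le> cmod ?m ^ 2 * (K0 * M ^ 3 * ((cmod s + cmod t) / cmod ?m) ^ 3)"
      by (intro mult_left_mono) auto
    also have "\<dots> = K0 * M ^ 3 * (cmod s + cmod t) ^ 3 * (1 / cmod ?m)"
      using m0 by (simp add: field_simps power2_eq_square power3_eq_cube)
    also have "\<dots> \<le> K0 * M ^ 3 * (cmod s + cmod t) ^ 3 * (2 / cmod \<kappa>)"
      using \<mu>[OF st] \<kappa>0 m0 K0(1) M by (intro mult_left_mono) (auto simp: divide_simps mult.commute)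
    also have "\<dots> = K * (cmod s + cmod t) ^ 3" by (simp add: K_def)
    also have "cmod ?m ^ 2 * cmod (h0 (s / ?m) (t / ?m) - e * (s / ?m) * (t / ?m)) = cmod (h s t - e * s * t)"
    proof -
      have "h s t - e * s * t = ?m ^ 2 * (h0 (s / ?m) (t / ?m) - e * (s / ?m) * (t / ?m))"
        using m0 by (simp add: h_def field_simps power2_eq_square)
      thus ?thesis by (simp add: norm_mult norm_power)
    qed
    finally show ?thesis .
  qed
  have cont: "continuous_on {p. cmod (fst p) + cmod (snd p) \<le> \<delta>} (\<lambda>p. h (fst p) (snd p))"
  proof -
    let ?S = "{p. cmod (fst p) + cmod (snd p) \<le> \<delta>}"
    have c\<mu>: "continuous_on ?S (\<lambda>p. \<mu> (fst p) (snd p))" unfolding \<mu>_def by (intro continuous_intros)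
    have "continuous_on ?S (\<lambda>p. (fst p / \<mu> (fst p) (snd p) * \<alpha>1 + snd p / \<mu> (fst p) (snd p) * \<alpha>2,
        fst p / \<mu> (fst p) (snd p) * \<beta>1 + snd p / \<mu> (fst p) (snd p) * \<beta>2))"
      using \<mu>0 by (intro continuous_intros c\<mu>) auto
    from continuous_on_compose2[OF continuous_on_eval2[of UNIV G] this]
    have "continuous_on ?S (\<lambda>p. h0 (fst p / \<mu> (fst p) (snd p)) (snd p / \<mu> (fst p) (snd p)))"
      by (simp add: h0_def)
    thus ?thesis unfolding h_def by (intro continuous_intros c\<mu>)
  qed
  obtain \<epsilon>1 where \<epsilon>1: "\<epsilon>1 > 0" "\<And>\<epsilon>. 0 < \<epsilon> \<Longrightarrow> \<epsilon> < \<epsilon>1 \<Longrightarrow> \<not> connected {x \<in> sphere 0 1.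
      h (of_real \<epsilon> * (s1 * fst x + s2 * snd x)) (of_real \<epsilon> * (t1 * fst x + t2 * snd x)) = 0}"
    using node_link_disconnected[OF e K \<delta> \<Delta>[unfolded \<Delta>_def] est cont] by blast
  define B where "B = 1 + cmod s1 + cmod s2 + cmod t1 + cmod t2"
  have B: "B \<ge> 1" by (simp add: B_def)
  have zero: "local_equation F A (\<epsilon> *\<^sub>R x) = 0 \<longleftrightarrow>
      h (of_real \<epsilon> * (s1 * fst x + s2 * snd x)) (of_real \<epsilon> * (t1 * fst x + t2 * snd x)) = 0"
    if \<epsilon>: "0 < \<epsilon>" "\<epsilon> < \<delta> / B" and x: "norm x = 1" for \<epsilon> x
  proof -
    define s t where "s = of_real \<epsilon> * (s1 * fst x + s2 * snd x)" and "t = of_real \<epsilon> * (t1 * fst x + t2 * snd x)"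
    have nx: "cmod (fst x) \<le> 1" "cmod (snd x) \<le> 1"
      using norm_fst_le[of "fst x" "snd x"] norm_snd_le[of "snd x" "fst x"] x by auto
    have lin: "cmod (k * fst x + l * snd x) \<le> cmod k + cmod l" for k l
    proof -
      have "cmod (k * fst x + l * snd x) \<le> cmod k * cmod (fst x) + cmod l * cmod (snd x)"
        by (metis norm_mult norm_triangle_ineq)
      also have "\<dots> \<le> cmod k * 1 + cmod l * 1" using nx by (intro add_mono mult_left_mono) auto
      finally show ?thesis by simp
    qed
    have "cmod s + cmod t = \<epsilon> * (cmod (s1 * fst x + s2 * snd x) + cmod (t1 * fst x + t2 * snd x))"
      using \<epsilon> unfolding s_def t_def norm_mult norm_of_real by (simp add: distrib_left)
    also have "\<dots> \<le> \<epsilon> * B" using lin[of s1 s2] lin[of t1 t2] \<epsilon> by (intro mult_left_mono) (auto simp: B_def)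
    also have "\<dots> \<le> \<delta>" using \<epsilon> B by (simp add: pos_less_divide_eq)
    finally have st: "cmod s + cmod t \<le> \<delta>" .
    have \<mu>_eq: "\<mu> s t = \<kappa> + of_real \<epsilon> * (m1 * fst x + m2 * snd x)"
    proof -
      have "\<Delta> * (n1 * s + n2 * t) = (m1 * t2 - m2 * t1) * s + (m2 * s1 - m1 * s2) * t"
        using \<Delta> by (simp add: n1_def n2_def field_simps)
      also have "\<dots> = \<Delta> * (of_real \<epsilon> * (m1 * fst x + m2 * snd x))"
        by (simp add: s_def t_def \<Delta>_def algebra_simps)
      finally show ?thesis using \<Delta> by (simp add: \<mu>_def add.assoc)
    qed
    have "column 1 A + fst (\<epsilon> *\<^sub>R x) *s column 2 A + snd (\<epsilon> *\<^sub>R x) *s column 3 A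
        = \<mu> s t *s v + s *s w1 + t *s w2"
      unfolding \<kappa> a2 a3 by (subst \<mu>_eq, unfold s_def t_def)
        (simp add: vec_eq_iff scaleR_conv_of_real algebra_simps)
    also have "\<dots> = \<mu> s t *s (v + (s / \<mu> s t) *s w1 + (t / \<mu> s t) *s w2)"
      using \<mu>0[OF st] by (simp add: vector_add_ldistrib vector_smult_assoc)
    finally have "local_equation F A (\<epsilon> *\<^sub>R x) = \<mu> s t ^ d * h0 (s / \<mu> s t) (t / \<mu> s t)"
      by (simp only: local_equation_altdef eval3_scale[OF F] h0_eq)
    thus ?thesis using \<mu>0[OF st] by (simp add: h_def flip: s_def t_def)
  qed
  show ?thesis
  proof (rule exI[of _ "min \<epsilon>1 (\<delta> / B)"], intro conjI allI impI)
    show "min \<epsilon>1 (\<delta> / B) > 0" using \<epsilon>1 \<delta> B by simp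
    fix \<epsilon> assume "0 < \<epsilon> \<and> \<epsilon> < min \<epsilon>1 (\<delta> / B)"
    hence \<epsilon>: "0 < \<epsilon>" "\<epsilon> < \<epsilon>1" "\<epsilon> < \<delta> / B" by auto
    have "{x \<in> sphere 0 1. local_equation F A (\<epsilon> *\<^sub>R x) = 0} = {x \<in> sphere 0 1.
      h (of_real \<epsilon> * (s1 * fst x + s2 * snd x)) (of_real \<epsilon> * (t1 * fst x + t2 * snd x)) = 0}"
      using zero[OF \<epsilon>(1,3)] by auto
    thus "\<not> connected {x \<in> sphere 0 1. local_equation F A (\<epsilon> *\<^sub>R x) = 0}" using \<epsilon>1(2)[OF \<epsilon>(1,2)] by simp
  qed
qed

text \<open>
  An isotopy provides a bijection between the components, so the link is the
  image of a single loop.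
\<close>

lemma link_with_one_component_connected:
  assumes "has_link F P T" "length T = 1"
  obtains A \<epsilon>0 where "invertible A" "column 1 A \<in> P" "\<epsilon>0 > 0"
    "\<And>\<epsilon>. 0 < \<epsilon> \<Longrightarrow> \<epsilon> < \<epsilon>0 \<Longrightarrow> connected {x \<in> sphere 0 1. local_equation F A (\<epsilon> *\<^sub>R x) = 0}"
proof -
  obtain A \<epsilon>0 where A: "invertible A" "column 1 A \<in> P" "\<epsilon>0 > 0" 
    and L: "\<And>\<epsilon>. 0 < \<epsilon> \<Longrightarrow> \<epsilon> < \<epsilon>0 \<Longrightarrow> \<exists>L. link_at_radius (local_equation F A) \<epsilon> L \<and> link_isotopic L T"
    using assms(1) unfolding has_link_def by blast
  show ?thesis
  proof (rule that[OF A])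
    fix \<epsilon> assume "0 < \<epsilon>" "\<epsilon> < \<epsilon>0"
    then obtain L where L: "link_at_radius (local_equation F A) \<epsilon> L" "link_isotopic L T" using L by blast
    obtain \<pi> where "bij_betw \<pi> {..<length L} {..<length T}" using L(2) unfolding link_isotopic_def by blast
    hence "length L = 1" using assms(2) bij_betw_same_card by fastforce
    then obtain \<gamma> where \<gamma>: "L = [\<gamma>]" by (auto simp: length_Suc_conv)
    have "oriented_knot \<gamma>" "range \<gamma> = {x \<in> sphere 0 1. local_equation F A (\<epsilon> *\<^sub>R x) = 0}"
      using L(1) by (auto simp: link_at_radius_def oriented_link_def \<gamma>)
    moreover from this have "continuous_on UNIV \<gamma>"
      by (auto simp: oriented_knot_def intro: C1_differentiable_imp_continuous_on)
    hence "connected (range \<gamma>)" by (rule connected_continuous_image) simp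
    ultimately show "connected {x \<in> sphere 0 1. local_equation F A (\<epsilon> *\<^sub>R x) = 0}" by simp
  qed
qed

lemma cusp_tangent_cone_degenerate:
  assumes F: "homogeneous_of_degree d F" and P: "ordinary_cusp F P"
    and v: "v \<in> P" "v \<noteq> 0" and T: "triple v u w \<noteq> 0"
  shows "chart_coeff F v u w 1 1 ^ 2 = 4 * chart_coeff F v u w 2 0 * chart_coeff F v u w 0 2"
proof (rule ccontr)
  assume nondeg: "\<not> ?thesis"
  have sing: "P \<in> singular_points F" and link: "has_link F P (torus_link 2 3)"
    using P by (auto simp: ordinary_cusp_def)
  have len: "length (torus_link 2 3) = 1"
  proof -
    have "gcd 2 (3 :: nat) = 1" by (simp add: gcd_nat.simps)
    thus ?thesis by (simp add: torus_link_def)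
  qed
  obtain A \<epsilon>1 where A: "invertible A" "column 1 A \<in> P" and \<epsilon>1: "\<epsilon>1 > 0"
    "\<And>\<epsilon>. 0 < \<epsilon> \<Longrightarrow> \<epsilon> < \<epsilon>1 \<Longrightarrow> connected {x \<in> sphere 0 1. local_equation F A (\<epsilon> *\<^sub>R x) = 0}"
    by (rule link_with_one_component_connected[OF link len]) blast
  obtain \<epsilon>2 where \<epsilon>2: "\<epsilon>2 > 0"
    "\<And>\<epsilon>. 0 < \<epsilon> \<Longrightarrow> \<epsilon> < \<epsilon>2 \<Longrightarrow> \<not> connected {x \<in> sphere 0 1. local_equation F A (\<epsilon> *\<^sub>R x) = 0}"
    using node_chart_disconnected[OF F sing v T nondeg A] by blast
  have "0 < min \<epsilon>1 \<epsilon>2 / 2" "min \<epsilon>1 \<epsilon>2 / 2 < \<epsilon>1" "min \<epsilon>1 \<epsilon>2 / 2 < \<epsilon>2"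
    using \<epsilon>1(1) \<epsilon>2(1) by (auto simp: min_def)
  thus False using \<epsilon>1(2) \<epsilon>2(2) by blast
qed

section \<open>The discriminant of a projection\<close>

text \<open>
  On the vertical line \<open>x = x0\<close> both \<open>G\<close> and its derivative in \<open>y\<close> vanish at \<open>y0\<close>; the
  cofactors \<open>b\<close> and \<open>a\<close> give the syzygy \<open>- a G + b G' = 0\<close> over that line. The curve \<open>y = c(x)\<close> through
  \<open>(x0, y0)\<close> is at our disposal, and the orders of \<open>G\<close> and \<open>G'\<close> along it bound the order of the
  discriminant from below. This covers curves \<open>G\<close> whose leading coefficient vanishes at \<open>x0\<close>.
\<close>

lemma root_power_dvd_discriminant:
  fixes G :: "complex poly poly" and a b c :: "complex poly" and x0 y0 :: complex
  defines "f0 \<equiv> slice x0 G"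
  assumes b: "f0 = [:-y0, 1:] * b" "b \<noteq> 0" "poly b y0 = 0"
    and a: "pderiv f0 = [:-y0, 1:] * a"
    and c: "poly c x0 = y0"
    and k: "[:-x0, 1:] ^ k dvd poly G c" "[:-x0, 1:] ^ k dvd poly (pderiv G) c"
    and corner: "[:-x0, 1:] ^ Suc k dvd poly G c \<or> poly a y0 = 0"
  shows "[:-x0, 1:] ^ Suc k dvd resultant G (pderiv G)"
proof -
  let ?\<pi> = "[:-x0, 1:]"
  define lift where "lift = map_poly (\<lambda>z::complex. [:z:])"
  have lift: "poly (poly (lift h) c) x = poly h (poly c x)" for h x
    by (induction h) (simp_all add: lift_def map_poly_pCons)
  have slice_lift: "slice x (lift h) = h" for h x
    by (rule poly_eqI) (simp add: lift_def coeff_map_poly)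
  have deg_lift: "degree (lift h) = degree h" for h
    unfolding lift_def by (rule degree_map_poly) simp
  have lift_dvd: "?\<pi> dvd poly (lift h) c" if "poly h y0 = 0" for h
    using that unfolding poly_eq_0_iff_dvd[symmetric] by (simp add: lift c)
  have "degree f0 = degree [:-y0, 1:] + degree b"
    unfolding b(1) by (rule degree_mult_eq) (use b(2) in simp_all)
  hence degf0: "degree f0 = Suc (degree b)" by simp
  have "degree f0 \<le> degree G" unfolding f0_def by (rule degree_map_poly_le)
  have a0: "a \<noteq> 0" using a degf0 by (auto simp: pderiv_eq_0_iff)
  have "degree (pderiv f0) = degree [:-y0, 1:] + degree a"
    unfolding a by (rule degree_mult_eq) (use a0 in simp_all)
  hence dega: "degree b = Suc (degree a)" using degf0 by (simp add: degree_pderiv)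
  define A B where "A = - lift a" and "B = lift b"
  show ?thesis
  proof (rule power_dvd_resultant[of A "pderiv G" B G ?\<pi> k c "degree b"])
    show "degree A < degree (pderiv G)"
      using degf0 dega \<open>degree f0 \<le> degree G\<close> by (simp add: A_def deg_lift degree_pderiv)
    show "degree B < degree G"
      using degf0 \<open>degree f0 \<le> degree G\<close> by (simp add: B_def deg_lift)
    have "slice x0 (A * G + B * pderiv G) = - a * f0 + b * pderiv f0"
    proof -
      have "slice x0 A = - a"
        using slice_lift[of x0 a] by (simp add: A_def poly_eq_iff coeff_map_poly)
      thus ?thesis by (simp add: slice_mult slice_add slice_pderiv f0_def B_def slice_lift)
    qed
    also have "\<dots> = 0"
    proof -
      have "- a * (l * b) + b * (l * a) = 0" for l by (simp add: algebra_simps)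
      thus ?thesis unfolding a unfolding b(1) .
    qed
    finally have 0: "slice x0 (A * G + B * pderiv G) = 0" .
    show "?\<pi> dvd coeff (A * G + B * pderiv G) j" for j
      using arg_cong[OF 0, of "\<lambda>p. coeff p j"] unfolding poly_eq_0_iff_dvd[symmetric]
      by (simp add: coeff_map_poly)
    show "?\<pi> ^ k dvd poly G c" "?\<pi> ^ k dvd poly (pderiv G) c" by fact+
    have "?\<pi> ^ Suc k dvd poly A c * poly G c"
      using corner
    proof
      assume "poly a y0 = 0"
      hence "?\<pi> dvd poly A c" using lift_dvd[of a] by (simp add: A_def)
      thus ?thesis unfolding power_Suc by (rule mult_dvd_mono[OF _ k(1)])
    qed (rule dvd_mult)
    moreover have "?\<pi> ^ Suc k dvd poly B c * poly (pderiv G) c"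
      unfolding power_Suc B_def by (rule mult_dvd_mono[OF lift_dvd[OF b(3)] k(2)])
    ultimately show "?\<pi> ^ Suc k dvd poly (A * G + B * pderiv G) c" by simp
    show "coeff B (degree b) dvd 1"
      using b(2) by (simp add: B_def lift_def coeff_map_poly is_unit_poly_iff dvd_field_iff)
  qed
qed

lemma linear_power_dvd_if_shifted_coeffs_0:
  fixes p :: "'a::idom poly"
  assumes "\<And>i. i < k \<Longrightarrow> coeff (pcompose p [:a, 1:]) i = 0"
  shows "[:-a, 1:] ^ k dvd p"
proof -
  have "monom 1 k dvd pcompose p [:a, 1:]" unfolding monom_1_dvd_iff' using assms by auto
  then obtain h where "pcompose p [:a, 1:] = monom 1 k * h" by (rule dvdE)
  hence "pcompose (pcompose p [:a, 1:]) [:-a, 1:] = pcompose (monom 1 k) [:-a, 1:] * pcompose h [:-a, 1:]"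
    by (simp add: pcompose_mult)
  moreover have "pcompose (pcompose p [:a, 1:]) [:-a, 1:] = p"
  proof -
    have "pcompose [:a, 1:] [:-a, 1:] = [:0, 1:]" by (simp add: pcompose_pCons)
    thus ?thesis by (simp only: pcompose_assoc[symmetric] pcompose_idR)
  qed
  moreover have "pcompose (monom 1 k) [:-a, 1:] = [:-a, 1:] ^ k"
    by (simp add: monom_altdef pcompose_hom.hom_power pcompose_pCons)
  ultimately show ?thesis by (metis dvd_triv_left)
qed

text \<open>
  For an arbitrary singular point take the horizontal line for the curve \<open>c\<close> of the lemma
  \<open>root_power_dvd_discriminant\<close>: \<open>G\<close> has order at least 2 along it and its derivative order at least 1.
  If the quadratic part is degenerate and contains \<open>y\<^sup>2\<close>, it is a multiple of a square \<open>(y - l x)\<^sup>2\<close>;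
  along the line of slope \<open>l\<close> the order of \<open>G\<close> is at least 3 and that of its derivative at least 2. If it
  does not contain \<open>y\<^sup>2\<close>, then it is a multiple of \<open>x\<^sup>2\<close>, and the horizontal line serves again, since the
  vertical line now meets the curve with multiplicity at least 3 and so the cofactor \<open>a\<close> vanishes at \<open>y0\<close>.
\<close>

lemma discriminant_order:
  assumes P: "P \<in> singular_points F" and v: "v \<in> P" "v \<noteq> 0"
    and v_eq: "v = p + x0 *s u + y0 *s w" and leaves: "eval3 F (v + t *s w) \<noteq> 0"
  defines "G \<equiv> chart F p u w" and "c \<equiv> chart_coeff F v u w"
  shows "[:-x0, 1:] ^ 2 dvd resultant G (pderiv G)"
    and "c 1 1 ^ 2 = 4 * c 2 0 * c 0 2 \<Longrightarrow> [:-x0, 1:] ^ 3 dvd resultant G (pderiv G)"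
    and "degree G \<ge> 1"
proof -
  define H where "H = chart F v u w"
  have GH: "eval2 G (x0 + x) (y0 + y) = eval2 H x y" for x y
  proof -
    have "p + (x0 + x) *s u + (y0 + y) *s w = v + x *s u + y *s w"
      by (simp add: v_eq vector_sadd_rdistrib)
    thus ?thesis unfolding G_def H_def eval2_chart by (rule arg_cong)
  qed
  have c0: "c 0 0 = 0" "c 1 0 = 0" "c 0 1 = 0"
    unfolding c_def by (rule chart_coeff_singular[OF P v])+
  define \<mu> where "\<mu> = [:-y0, 1:]"
  define f0 where "f0 = slice x0 G"
  define g where "g = slice 0 H"
  have f0g: "pcompose f0 [:y0, 1:] = g"
    using GH[where x = 0] by (simp add: poly_eq_poly_eq_iff[symmetric] fun_eq_iff poly_pcompose f0_def g_def poly_slice)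
  have coeff_g: "coeff g j = c 0 j" for j
    by (simp add: g_def coeff_map_poly poly_0_coeff_0 c_def chart_coeff_def H_def)
  have "\<mu> ^ 2 dvd f0" unfolding \<mu>_def
    by (rule linear_power_dvd_if_shifted_coeffs_0, unfold f0g coeff_g) (use c0 in \<open>auto simp: less_2_cases_iff\<close>)
  then obtain h where h: "f0 = \<mu> ^ 2 * h" by (rule dvdE)
  define a b where "a = 2 * h + \<mu> * pderiv h" and "b = \<mu> * h"
  have "poly g t \<noteq> 0" using leaves by (simp add: g_def poly_slice H_def eval2_chart)
  hence "f0 \<noteq> 0" using f0g by auto
  have b1: "f0 = \<mu> * b" by (simp only: h b_def power2_eq_square mult.assoc)
  moreover have "b \<noteq> 0" using b1 \<open>f0 \<noteq> 0\<close> by auto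
  moreover have "poly b y0 = 0" by (simp add: b_def \<mu>_def)
  ultimately have b: "f0 = \<mu> * b" "b \<noteq> 0" "poly b y0 = 0" by auto
  have pd\<mu>: "pderiv \<mu> = 1" by (simp add: \<mu>_def pderiv_pCons)
  have a: "pderiv f0 = \<mu> * a"
    by (simp add: h a_def pderiv_mult power2_eq_square pd\<mu> algebra_simps)
  have poly_a: "poly a y0 = 2 * c 0 2"
  proof -
    have "g = pcompose (\<mu> ^ 2 * h) [:y0, 1:]" by (simp add: h flip: f0g)
    also have "\<dots> = pcompose \<mu> [:y0, 1:] ^ 2 * pcompose h [:y0, 1:]"
      by (simp only: pcompose_mult power2_eq_square)
    also have "pcompose \<mu> [:y0, 1:] = [:0, 1:]" by (simp add: \<mu>_def pcompose_pCons)
    finally have "coeff g 2 = poly (pcompose h [:y0, 1:]) 0"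
      by (simp add: power2_eq_square coeff_pCons poly_0_coeff_0 numeral_2_eq_2)
    thus ?thesis by (simp add: coeff_g a_def \<mu>_def poly_pcompose)
  qed
  show "degree G \<ge> 1"
  proof -
    have "degree f0 = degree \<mu> + degree b"
      unfolding b(1) by (rule degree_mult_eq) (use b(2) in \<open>simp_all add: \<mu>_def\<close>)
    moreover have "degree f0 \<le> degree G" unfolding f0_def by (rule degree_map_poly_le)
    ultimately show ?thesis by (simp add: \<mu>_def)
  qed
  have dvd_G: "[:-x0, 1:] ^ k dvd poly G [:y0 - l * x0, l:]"
    and dvd_G': "[:-x0, 1:] ^ m dvd poly (pderiv G) [:y0 - l * x0, l:]"
    if k: "k \<le> 3" "k = 3 \<Longrightarrow> c 2 0 + l * c 1 1 + l\<^sup>2 * c 0 2 = 0"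
      and m: "m \<le> 2" "m = 2 \<Longrightarrow> c 1 1 + 2 * l * c 0 2 = 0" for k m l
  proof -
    obtain g0 g1 g2 r where H: "H = pCons g0 (pCons g1 (pCons g2 r))" by (metis pCons_cases)
    have c: "c i 0 = coeff g0 i" "c i (Suc 0) = coeff g1 i" "c i (Suc (Suc 0)) = coeff g2 i" for i
      by (simp_all add: c_def chart_coeff_def H numeral_2_eq_2 flip: H_def)
    have "pcompose (poly G [:y0 - l * x0, l:]) [:x0, 1:] = poly H [:0, l:]"
    proof (rule poly_ext)
      fix \<tau>
      have e: "poly (poly K q) s = eval2 K s (poly q s)" for K and q :: "complex poly" and s
        by (induction K) simp_all
      show "poly (pcompose (poly G [:y0 - l * x0, l:]) [:x0, 1:]) \<tau> = poly (poly H [:0, l:]) \<tau>"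
        using GH[where x = \<tau> and y = "l * \<tau>"] by (simp add: poly_pcompose e[of _ "[:_, _:]"] algebra_simps)
    qed
    moreover have "coeff (poly H [:0, l:]) i = 0" if "i < k" for i
    proof -
      have "i = 0 \<or> i = 1 \<or> (i = 2 \<and> k = 3)" using that k by auto
      thus ?thesis using c0 k(2)
        by (auto simp: H c numeral_2_eq_2 power2_eq_square algebra_simps)
    qed
    ultimately show "[:-x0, 1:] ^ k dvd poly G [:y0 - l * x0, l:]"
      by (intro linear_power_dvd_if_shifted_coeffs_0) simp
    have "pcompose (poly (pderiv G) [:y0 - l * x0, l:]) [:x0, 1:] = poly (pderiv H) [:0, l:]"
    proof (rule poly_ext)
      fix \<tau>
      have e: "poly (poly K q) s = eval2 K s (poly q s)" for K and q :: "complex poly" and s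
        by (induction K) simp_all
      have "pcompose (slice (x0 + \<tau>) G) [:y0, 1:] = slice \<tau> H"
        using GH[where x = \<tau>] by (simp add: poly_eq_poly_eq_iff[symmetric] fun_eq_iff poly_pcompose poly_slice)
      from arg_cong[OF this, of pderiv]
      have "pcompose (slice (x0 + \<tau>) (pderiv G)) [:y0, 1:] = slice \<tau> (pderiv H)"
        by (simp add: pderiv_pcompose pderiv_pCons slice_pderiv)
      from arg_cong[OF this, of "\<lambda>p. poly p (l * \<tau>)"]
      show "poly (pcompose (poly (pderiv G) [:y0 - l * x0, l:]) [:x0, 1:]) \<tau> = poly (poly (pderiv H) [:0, l:]) \<tau>"
        by (simp add: poly_pcompose poly_slice e[of _ "[:_, _:]"] algebra_simps)
    qed
    moreover have "coeff (poly (pderiv H) [:0, l:]) i = 0" if "i < m" for i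
    proof -
      have "i = 0 \<or> (i = 1 \<and> m = 2)" using that m by auto
      moreover have "coeff (g2 * 2) 0 = 2 * coeff g2 0" by (simp only: mult_2_right mult_2 coeff_add)
      ultimately show ?thesis using c0 m(2)
        by (auto simp: H c numeral_2_eq_2 pderiv_pCons algebra_simps)
    qed
    ultimately show "[:-x0, 1:] ^ m dvd poly (pderiv G) [:y0 - l * x0, l:]"
      by (intro linear_power_dvd_if_shifted_coeffs_0) simp
  qed
  note order = root_power_dvd_discriminant[OF b[unfolded f0_def \<mu>_def] a[unfolded f0_def \<mu>_def]]
  have Suc: "Suc 1 = 2" "Suc 2 = 3" by simp_all
  have "[:-x0, 1:] ^ Suc 1 dvd resultant G (pderiv G)"
  proof (rule order[where c = "[:y0 - 0 * x0, 0:]"])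
    show "poly [:y0 - 0 * x0, 0:] x0 = y0" by simp
    show "[:-x0, 1:] ^ 1 dvd poly G [:y0 - 0 * x0, 0:]" by (rule dvd_G[where k = 1 and m = 0]) auto
    show "[:-x0, 1:] ^ 1 dvd poly (pderiv G) [:y0 - 0 * x0, 0:]" by (rule dvd_G'[where k = 0 and m = 1]) auto
    show "[:-x0, 1:] ^ Suc 1 dvd poly G [:y0 - 0 * x0, 0:] \<or> poly a y0 = 0"
      unfolding Suc by (intro disjI1 dvd_G[where k = 2 and m = 0]) auto
  qed
  thus "[:-x0, 1:] ^ 2 dvd resultant G (pderiv G)" unfolding Suc .
  show "[:-x0, 1:] ^ 3 dvd resultant G (pderiv G)" if cusp: "c 1 1 ^ 2 = 4 * c 2 0 * c 0 2"
  proof -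
    \<comment> \<open>the slope of the double tangent, or 0 if the quadratic part does not contain \<open>y\<^sup>2\<close>\<close>
    define l where "l = (if c 0 2 = 0 then 0 else - c 1 1 / (2 * c 0 2))"
    have l1: "c 1 1 + 2 * l * c 0 2 = 0" using cusp by (auto simp: l_def)
    have l2: "c 2 0 + l * c 1 1 + l\<^sup>2 * c 0 2 = 0" if "c 0 2 \<noteq> 0"
      using cusp that by (simp add: l_def field_simps power2_eq_square)
    have "[:-x0, 1:] ^ Suc 2 dvd resultant G (pderiv G)"
    proof (rule order[where c = "[:y0 - l * x0, l:]"])
      show "poly [:y0 - l * x0, l:] x0 = y0" by (simp add: algebra_simps)
      show "[:-x0, 1:] ^ 2 dvd poly G [:y0 - l * x0, l:]"
        by (rule dvd_G[where k = 2 and m = 0]) auto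
      show "[:-x0, 1:] ^ 2 dvd poly (pderiv G) [:y0 - l * x0, l:]"
        by (rule dvd_G'[where k = 0 and m = 2]) (use l1 in auto)
      show "[:-x0, 1:] ^ Suc 2 dvd poly G [:y0 - l * x0, l:] \<or> poly a y0 = 0"
      proof (cases "c 0 2 = 0")
        case False
        show ?thesis unfolding Suc by (intro disjI1 dvd_G[where k = 3 and m = 0]) (use l2[OF False] in auto)
      qed (simp add: poly_a)
    qed
    thus ?thesis unfolding Suc .
  qed
qed

lemma coeffs_pcompose_shift:
  fixes p :: "'a::{idom,semiring_char_0} poly"
  shows "coeff (pcompose p [:a, 1:]) 0 = poly p a" "coeff (pcompose p [:a, 1:]) 1 = poly (pderiv p) a"
proof -
  show "coeff (pcompose p [:a, 1:]) 0 = poly p a"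
    by (simp flip: poly_0_coeff_0 add: poly_pcompose)
  have "coeff (pcompose p [:a, 1:]) 1 = poly (pderiv (pcompose p [:a, 1:])) 0"
    by (simp add: poly_0_coeff_0 coeff_pderiv)
  also have "\<dots> = poly (pderiv p) a" by (simp add: pderiv_pcompose poly_pcompose pderiv_pCons)
  finally show "coeff (pcompose p [:a, 1:]) 1 = poly (pderiv p) a" .
qed

lemma prime_factor_of_positive_degree:
  fixes g :: "complex poly poly"
  assumes "degree g > 0"
  obtains H where "prime_elem H" "H dvd g" "degree H > 0"
proof -
  have g: "g \<noteq> 0" using assms by auto
  obtain A where A: "\<forall>H. H \<in># A \<longrightarrow> prime_elem H" "normalize (prod_mset A) = normalize g"
    using prime_factorization_exists[OF g] by blast
  have dvd: "prod_mset A dvd g" "g dvd prod_mset A"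
    using associatedD1[OF A(2)] associatedD2[OF A(2)] .
  have "degree (prod_mset B) = 0" if "\<forall>H. H \<in># B \<longrightarrow> degree H = 0" for B :: "complex poly poly multiset"
    using that
  proof (induction B)
    case (add H B)
    thus ?case using degree_mult_le[of H "prod_mset B"] by simp
  qed simp
  moreover have "prod_mset A \<noteq> 0" using dvd(1) g by auto
  hence "degree (prod_mset A) > 0" using dvd_imp_degree_le[OF dvd(2)] assms by simp
  ultimately obtain H where H: "H \<in># A" "degree H > 0" by (metis gr0I less_irrefl)
  have "H dvd g" using dvd_prod_mset[OF H(1)] dvd(1) by (rule dvd_trans)
  thus ?thesis using that A(1) H by blast
qed

text \<open>
  If the discriminant vanishes identically, then \<open>G\<close> and its derivative share a prime factor \<open>H\<close> of positive
  degree in \<open>y\<close>. It cannot divide its own derivative, so \<open>H\<^sup>2\<close> divides \<open>G\<close>. Hence all points of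
  \<open>H = 0\<close> are singular, and there is such a point on almost every vertical line.
\<close>

lemma discriminant_nonzero:
  assumes F: "homogeneous_of_degree d F" and fin: "finite (singular_points F)"
    and T: "triple p u w \<noteq> 0"
  defines "G \<equiv> chart F p u w"
  assumes deg: "degree G \<ge> 1"
  shows "resultant G (pderiv G) \<noteq> 0"
proof
  assume "resultant G (pderiv G) = 0"
  hence "degree (gcd G (pderiv G)) > 0" using resultant_0_gcd by blast
  then obtain H where H: "prime_elem H" "H dvd gcd G (pderiv G)" "degree H > 0"
    by (rule prime_factor_of_positive_degree)
  hence "H dvd G" "H dvd pderiv G" by auto
  then obtain K where K: "G = H * K" by (auto elim: dvdE)
  have "H dvd H * pderiv K + K * pderiv H"
    using \<open>H dvd pderiv G\<close> by (simp add: K pderiv_mult)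
  hence "H dvd K * pderiv H" by (simp add: dvd_add_right_iff)
  moreover have "\<not> H dvd pderiv H"
  proof
    assume "H dvd pderiv H"
    moreover have "pderiv H \<noteq> 0" using H(3) by (simp add: pderiv_eq_0_iff)
    ultimately have "degree H \<le> degree (pderiv H)" by (rule dvd_imp_degree_le)
    thus False using H(3) by (simp add: degree_pderiv)
  qed
  ultimately have "H dvd K" using H(1) by (auto simp: prime_elem_dvd_mult_iff)
  then obtain B where "K = H * B" by (auto elim: dvdE)
  hence G: "G = H * H * B" by (simp add: K mult.assoc)
  \<comment> \<open>on these vertical lines the degree of \<open>H\<close> does not drop, so \<open>H\<close> has a zero\<close>
  define X where "X = {x. poly (lead_coeff H) x \<noteq> 0}"
  have "H \<noteq> 0" using H(3) by auto
  hence "finite (- X)" by (auto simp: X_def Compl_eq intro!: poly_roots_finite)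
  hence X: "infinite X" using infinite_UNIV_char_0[where 'a = complex] by (metis Compl_partition finite_UnI)
  have "\<exists>y. eval2 H x y = 0" if "x \<in> X" for x
  proof -
    have "degree (slice x H) = degree H"
      using that by (intro degree_map_poly) (auto simp: X_def)
    hence "\<not> constant (poly (slice x H))" using H(3) by (simp add: constant_degree)
    from fundamental_theorem_of_algebra[OF this] show ?thesis by (simp add: poly_slice)
  qed
  then obtain Y where Y: "\<And>x. x \<in> X \<Longrightarrow> eval2 H x (Y x) = 0" by metis
  define v where "v x = p + x *s u + Y x *s w" for x
  have tv: "triple (v x) u w = triple p u w" "triple p (v x) w = x * triple p u w" for x
    by (simp_all add: v_def triple_def algebra_simps)
  have "vec.span {v x} \<in> singular_points F" if x: "x \<in> X" for x
  proof (rule singular_pointI[OF F])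
    show "triple (v x) u w \<noteq> 0" using T by (simp add: tv)
    let ?g = "poly G [:Y x:]" and ?h = "slice x G"
    have e: "eval3 F (p + s *s u + t *s w) = eval2 G s t" for s t
      by (simp only: G_def eval2_chart)
    show "poly (pcompose ?g [:x, 1:]) \<tau> = eval3 F (v x + \<tau> *s u)" for \<tau>
      using e[of "x + \<tau>" "Y x"] by (simp add: poly_pcompose v_def vector_sadd_rdistrib add_ac)
    show "poly (pcompose ?h [:Y x, 1:]) \<tau> = eval3 F (v x + \<tau> *s w)" for \<tau>
      using e[of x "Y x + \<tau>"] by (simp add: poly_pcompose v_def vector_sadd_rdistrib poly_slice add_ac)
    have g: "?g = poly H [:Y x:] * poly H [:Y x:] * poly B [:Y x:]" by (simp add: G)
    have h: "?h = slice x H * slice x H * slice x B"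
      by (simp add: G slice_mult)
    show "coeff (pcompose ?g [:x, 1:]) 0 = 0" "coeff (pcompose ?g [:x, 1:]) 1 = 0"
      unfolding coeffs_pcompose_shift by (simp_all add: g pderiv_mult Y[OF x])
    show "coeff (pcompose ?h [:Y x, 1:]) 1 = 0"
      unfolding coeffs_pcompose_shift by (simp add: h pderiv_mult poly_slice Y[OF x])
  qed
  moreover have "inj_on (\<lambda>x. vec.span {v x}) X"
  proof (rule inj_onI)
    fix x x' assume "vec.span {v x} = vec.span {v x'}"
    hence "v x \<in> vec.span {v x'}" using vec.span_base[of "v x" "{v x}"] by simp
    then obtain k where k: "v x = k *s v x'" by (auto simp: vec.span_singleton)
    have tk: "triple (k *s z) u w = k * triple z u w" "triple p (k *s z) w = k * triple p z w" for z
      by (simp_all add: triple_def algebra_simps)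
    have "triple (v x) u w = k * triple (v x') u w" "triple p (v x) w = k * triple p (v x') w"
      by (simp_all only: k tk)
    thus "x = x'" using T by (simp add: tv)
  qed
  ultimately have "finite X" using fin by (meson finite_imageD finite_subset image_subsetI)
  thus False using X by simp
qed

section \<open>The class estimate and the bound on the number of cusps\<close>

text \<open>
  The lines that join a point \<open>r\<close> off the curve to the points \<open>w0 + s w1\<close> each contain a point \<open>q s\<close> of
  the curve. These are different points, so all but finitely many of them avoid the given points \<open>v\<close> and the lines
  that join two of them, because each of these lines meets the curve in finitely many points.
\<close>

lemma exists_projection_centre:
  assumes irr: "irreducible F" and F: "homogeneous_of_degree d F" and d: "d \<ge> 2"
    and V: "finite V" "\<And>v. v \<in> V \<Longrightarrow> v \<noteq> 0" "\<And>v. v \<in> V \<Longrightarrow> eval3 F v = 0"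
      "\<And>v v'. v \<in> V \<Longrightarrow> v' \<in> V \<Longrightarrow> v \<noteq> v' \<Longrightarrow> \<exists>r. triple v v' r \<noteq> 0"
  obtains q where "eval3 F q = 0" "\<And>v. v \<in> V \<Longrightarrow> \<exists>r. triple v r q \<noteq> 0"
    "\<And>v v'. v \<in> V \<Longrightarrow> v' \<in> V \<Longrightarrow> v \<noteq> v' \<Longrightarrow> triple v v' q \<noteq> 0"
proof -
  have "F \<noteq> 0" using F by (simp add: homogeneous_of_degree_def)
  then obtain r where r: "eval3 F r \<noteq> 0" using eval3_eq_0_imp_0 by blast
  have "r \<noteq> 0" using r eval3_scale[OF F, of 0 0] d by (auto simp: power_0_left)
  then obtain w0 w1 where T: "triple w0 w1 r \<noteq> 0" by (rule basis_extension)
  have "\<exists>t. eval3 F (w0 + s *s w1 + t *s r) = 0" for s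
  proof -
    let ?p = "slice s (chart F w0 w1 r)"
    have "coeff ?p d \<noteq> 0" using r by (simp add: coeff_map_poly coeff_chart_degree[OF F])
    hence "d \<le> degree ?p" by (rule le_degree)
    hence "degree ?p \<noteq> 0" using d by linarith
    hence "\<not> constant (poly ?p)" by (simp add: constant_degree)
    from fundamental_theorem_of_algebra[OF this] show ?thesis by (simp add: poly_slice eval2_chart)
  qed
  then obtain \<tau> where \<tau>: "\<And>s. eval3 F (w0 + s *s w1 + \<tau> s *s r) = 0" by metis
  define q where "q s = w0 + s *s w1 + \<tau> s *s r" for s
  have tq: "triple (q s) w1 r = triple w0 w1 r" "triple w0 (q s) r = s * triple w0 w1 r" for s
    by (simp_all add: q_def triple_def algebra_simps)
  \<comment> \<open>different parameters give different points of the projective plane\<close>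
  have ray: "finite {s. \<exists>k. q s = k *s z}" for z
  proof (rule finite_subset)
    show "{s. \<exists>k. q s = k *s z} \<subseteq> {triple w0 z r / triple z w1 r}"
    proof
      fix s assume "s \<in> {s. \<exists>k. q s = k *s z}"
      then obtain k where k: "q s = k *s z" by blast
      have "triple (q s) w1 r = k * triple z w1 r" "triple w0 (q s) r = k * triple w0 z r"
        by (simp_all add: k) (simp_all add: triple_def algebra_simps)
      hence 1: "triple w0 w1 r = k * triple z w1 r" "s * triple w0 w1 r = k * triple w0 z r"
        by (simp_all add: tq)
      have "k \<noteq> 0" "triple z w1 r \<noteq> 0" using 1 T by auto
      moreover have "k * (s * triple z w1 r) = k * triple w0 z r" using 1 by (simp add: mult_ac)
      ultimately show "s \<in> {triple w0 z r / triple z w1 r}" by (simp add: divide_simps)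
    qed
  qed simp
  have line: "finite {s. triple v v' (q s) = 0}" if vv: "v \<in> V" "v' \<in> V" "v \<noteq> v'" for v v'
  proof -
    obtain r' where r': "triple v v' r' \<noteq> 0" using V(4)[OF vv] by blast
    define p where "p = slice 0 (chart F v 0 v')"
    have p: "poly p t = eval3 F (v + t *s v')" for t by (simp add: p_def poly_slice eval2_chart)
    obtain t where "eval3 F (v + t *s v') \<noteq> 0"
      using line_leaves_irreducible_curve[OF irr F d r' V(3)[OF vv(2)]] by blast
    hence "p \<noteq> 0" using p[of t] by auto
    hence "finite {t. poly p t = 0}" by (rule poly_roots_finite)
    hence fin: "finite ({s. \<exists>k. q s = k *s v'} \<union> (\<Union>t\<in>{t. poly p t = 0}. {s. \<exists>k. q s = k *s (v + t *s v')}))"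
      by (intro finite_UnI finite_UN_I ray)
    have "{s. triple v v' (q s) = 0} \<subseteq>
      {s. \<exists>k. q s = k *s v'} \<union> (\<Union>t\<in>{t. poly p t = 0}. {s. \<exists>k. q s = k *s (v + t *s v')})"
    proof
      fix s assume "s \<in> {s. triple v v' (q s) = 0}"
      then obtain a b where ab: "q s = a *s v + b *s v'"
        using triple_basis[OF r', of "q s"] by auto
      show "s \<in> {s. \<exists>k. q s = k *s v'} \<union> (\<Union>t\<in>{t. poly p t = 0}. {s. \<exists>k. q s = k *s (v + t *s v')})"
      proof (cases "a = 0")
        case True
        thus ?thesis using ab by auto
      next
        case False
        hence eq: "q s = a *s (v + (b / a) *s v')"
          by (simp add: ab vector_add_ldistrib vector_smult_assoc)
        have "eval3 F (q s) = a ^ d * poly p (b / a)" by (simp only: eq eval3_scale[OF F] p)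
        moreover have "eval3 F (q s) = 0" unfolding q_def by (rule \<tau>)
        ultimately have "poly p (b / a) = 0" using False by simp
        thus ?thesis using eq by blast
      qed
    qed
    thus ?thesis using fin by (rule finite_subset)
  qed
  have "finite ((\<Union>v\<in>V. {s. \<exists>k. q s = k *s v}) \<union>
      (\<Union>(v, v')\<in>{(v, v'). v \<in> V \<and> v' \<in> V \<and> v \<noteq> v'}. {s. triple v v' (q s) = 0}))"
  proof (rule finite_UnI)
    show "finite (\<Union>v\<in>V. {s. \<exists>k. q s = k *s v})" by (intro finite_UN_I V(1) ray)
    have "finite {(v, v'). v \<in> V \<and> v' \<in> V \<and> v \<noteq> v'}"
      by (rule finite_subset[of _ "V \<times> V"]) (use V(1) in auto)
    thus "finite (\<Union>(v, v')\<in>{(v, v'). v \<in> V \<and> v' \<in> V \<and> v \<noteq> v'}. {s. triple v v' (q s) = 0})"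
    proof (rule finite_UN_I)
      fix z assume "z \<in> {(v, v'). v \<in> V \<and> v' \<in> V \<and> v \<noteq> v'}"
      thus "finite (case z of (v, v') \<Rightarrow> {s. triple v v' (q s) = 0})" using line by (cases z) simp
    qed
  qed
  then obtain s where s: "s \<notin> (\<Union>v\<in>V. {s. \<exists>k. q s = k *s v}) \<union>
      (\<Union>(v, v')\<in>{(v, v'). v \<in> V \<and> v' \<in> V \<and> v \<noteq> v'}. {s. triple v v' (q s) = 0})"
    using ex_new_if_finite[OF infinite_UNIV_char_0] by blast
  show ?thesis
  proof (rule that[of "q s"])
    show "eval3 F (q s) = 0" unfolding q_def by (rule \<tau>)
    show "\<exists>r. triple v r (q s) \<noteq> 0" if v: "v \<in> V" for v
    proof (rule ccontr)
      assume *: "\<not> ?thesis"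
      have "triple (q s) v r = 0" for r
      proof -
        have "triple (q s) v r = triple v r (q s)" by (simp add: triple_def algebra_simps)
        thus ?thesis using * by simp
      qed
      then obtain k where "q s = k *s v" using V(2)[OF v] by (rule dependent_if_triple_0)
      thus False using s v by blast
    qed
    show "triple v v' (q s) \<noteq> 0" if "v \<in> V" "v' \<in> V" "v \<noteq> v'" for v v'
      using s that by blast
  qed
qed

text \<open>
  The point \<open>(1, s, s\<^sup>2)\<close> runs through a conic, which meets the line joining \<open>q\<close> to \<open>v\<close> at most twice.
\<close>

lemma exists_line_avoiding_points:
  assumes V: "finite V" "\<And>v. v \<in> V \<Longrightarrow> \<exists>r. triple v r q \<noteq> 0"
  obtains u where "\<And>v. v \<in> V \<Longrightarrow> triple v u q \<noteq> 0"
proof -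
  define n where "n v = [:q $ 2 * v $ 3 - q $ 3 * v $ 2, q $ 3 * v $ 1 - q $ 1 * v $ 3,
     q $ 1 * v $ 2 - q $ 2 * v $ 1:]" for v :: "complex^3"
  have n: "poly (n v) s = triple v (vector [1, s, s\<^sup>2]) q" for v s
    by (simp add: n_def triple_def power2_eq_square algebra_simps)
  have "n v \<noteq> 0" if v: "v \<in> V" for v
  proof
    assume "n v = 0"
    hence "q $ 2 * v $ 3 - q $ 3 * v $ 2 = 0" "q $ 3 * v $ 1 - q $ 1 * v $ 3 = 0"
      "q $ 1 * v $ 2 - q $ 2 * v $ 1 = 0" by (simp_all add: n_def)
    moreover have "triple v r q = (q $ 2 * v $ 3 - q $ 3 * v $ 2) * r $ 1
        + (q $ 3 * v $ 1 - q $ 1 * v $ 3) * r $ 2 + (q $ 1 * v $ 2 - q $ 2 * v $ 1) * r $ 3" for r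
      by (simp add: triple_def algebra_simps)
    ultimately have "triple v r q = 0" for r by (simp only: mult_zero_left add_0)
    thus False using V(2)[OF v] by blast
  qed
  hence "finite (\<Union>v\<in>V. {s. poly (n v) s = 0})"
    by (intro finite_UN_I V(1) poly_roots_finite)
  then obtain s where "s \<notin> (\<Union>v\<in>V. {s. poly (n v) s = 0})"
    using ex_new_if_finite[OF infinite_UNIV_char_0] by blast
  thus ?thesis using that[of "vector [1, s, s\<^sup>2]"] by (auto simp: n)
qed

lemma sum_order_le_degree:
  fixes p :: "'a::idom poly"
  assumes "p \<noteq> 0" "finite X"
  shows "(\<Sum>x\<in>X. order x p) \<le> degree p"
proof -
  have "(\<Sum>x\<in>X. order x p) = (\<Sum>x\<in>X. count (proots p) x)" using assms by simp
  also have "\<dots> = (\<Sum>x\<in>X \<inter> set_mset (proots p). count (proots p) x)"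
    using assms by (intro sum.mono_neutral_right) (auto simp: order_gt_0_iff)
  also have "\<dots> \<le> (\<Sum>x\<in>set_mset (proots p). count (proots p) x)"
    by (intro sum_mono2) auto
  also have "\<dots> = size (proots p)" by (simp add: size_multiset_overloaded_eq)
  also have "\<dots> \<le> degree p" by (rule size_proots_le)
  finally show ?thesis .
qed

text \<open>
  The sum of the orders of the discriminant at the first coordinates of the singular points is at most
  its degree. Any singular point may serve as the origin \<open>p\<close> of the chart, because the line through \<open>q\<close> and
  \<open>u\<close>, which becomes the line at infinity, contains none of them.
\<close>

lemma class_bound:
  assumes irr: "irreducible F" and F: "homogeneous_of_degree d F"
    and sing: "singular_points F = N \<union> K" "N \<inter> K = {}" "finite N" "finite K" "N \<union> K \<noteq> {}"
    and cusps: "\<forall>P\<in>K. ordinary_cusp F P"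
  shows "2 * card N + 3 * card K + d + 1 \<le> d * d"
proof -
  define S where "S = N \<union> K"
  have S: "finite S" "singular_points F = S" "S \<noteq> {}" using sing by (auto simp: S_def)
  have d: "d \<ge> 2" using degree_ge_2_if_singular[OF F] S by blast
  have "\<exists>v. v \<noteq> 0 \<and> P = vec.span {v}" if "P \<in> S" for P
    using that S(2) by (auto simp: singular_points_def curve_def CP2_def)
  then obtain rep where rep: "\<And>P. P \<in> S \<Longrightarrow> rep P \<noteq> 0" "\<And>P. P \<in> S \<Longrightarrow> P = vec.span {rep P}" by metis
  have rep_in: "rep P \<in> P" if "P \<in> S" for P
    using rep(2)[OF that] vec.span_base[of "rep P" "{rep P}"] by simp
  have indep: "\<exists>r. triple (rep P) (rep P') r \<noteq> 0" if PP: "P \<in> S" "P' \<in> S" "P \<noteq> P'" for P P'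
  proof (rule ccontr)
    assume "\<not> ?thesis"
    hence "triple (rep P) (rep P') r = 0" for r by blast
    then obtain k where k: "rep P = k *s rep P'" using rep(1)[OF PP(2)] by (rule dependent_if_triple_0)
    have "k \<noteq> 0" using k rep(1)[OF PP(1)] by auto
    hence "vec.span {k *s rep P'} = vec.span {rep P'}" by (auto simp: vec.span_singleton image_iff vector_smult_assoc)
       (metis nonzero_mult_div_cancel_right times_divide_eq_left)
    hence "P = P'" using rep(2) PP(1,2) k by metis
    thus False using PP(3) by simp
  qed
  have inj: "inj_on rep S"
    using rep(2) by (metis inj_onI)
  have F0: "eval3 F (rep P) = 0" if "P \<in> S" for P
    using that S(2) rep_in[OF that] rep(1)[OF that] by (auto simp: singular_points_def curve_def)
  have "\<exists>q. eval3 F q = 0 \<and> (\<forall>P\<in>S. \<exists>r. triple (rep P) r q \<noteq> 0) \<and>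
      (\<forall>P\<in>S. \<forall>P'\<in>S. P \<noteq> P' \<longrightarrow> triple (rep P) (rep P') q \<noteq> 0)"
  proof (rule exists_projection_centre[OF irr F d, of "rep ` S"])
    show "finite (rep ` S)" using S(1) by simp
    show "v \<noteq> 0" "eval3 F v = 0" if "v \<in> rep ` S" for v using that rep(1) F0 by auto
    show "\<exists>r. triple v v' r \<noteq> 0" if "v \<in> rep ` S" "v' \<in> rep ` S" "v \<noteq> v'" for v v'
      using that indep by auto
    fix q assume q: "eval3 F q = 0" "\<And>v. v \<in> rep ` S \<Longrightarrow> \<exists>r. triple v r q \<noteq> 0"
      "\<And>v v'. v \<in> rep ` S \<Longrightarrow> v' \<in> rep ` S \<Longrightarrow> v \<noteq> v' \<Longrightarrow> triple v v' q \<noteq> 0"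
    have "triple (rep P) (rep P') q \<noteq> 0" if "P \<in> S" "P' \<in> S" "P \<noteq> P'" for P P'
      using that q(3)[of "rep P" "rep P'"] inj by (simp add: inj_on_eq_iff)
    thus "\<exists>q. eval3 F q = 0 \<and> (\<forall>P\<in>S. \<exists>r. triple (rep P) r q \<noteq> 0) \<and>
        (\<forall>P\<in>S. \<forall>P'\<in>S. P \<noteq> P' \<longrightarrow> triple (rep P) (rep P') q \<noteq> 0)"
      using q(1,2) by (intro exI[of _ q]) simp
  qed
  then obtain q where q': "eval3 F q = 0 \<and> (\<forall>P\<in>S. \<exists>r. triple (rep P) r q \<noteq> 0) \<and>
      (\<forall>P\<in>S. \<forall>P'\<in>S. P \<noteq> P' \<longrightarrow> triple (rep P) (rep P') q \<noteq> 0)" ..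
  have q: "eval3 F q = 0" "\<And>P. P \<in> S \<Longrightarrow> \<exists>r. triple (rep P) r q \<noteq> 0"
      "\<And>P P'. P \<in> S \<Longrightarrow> P' \<in> S \<Longrightarrow> P \<noteq> P' \<Longrightarrow> triple (rep P) (rep P') q \<noteq> 0"
    using q' by simp_all
  obtain u where u: "\<And>P. P \<in> S \<Longrightarrow> triple (rep P) u q \<noteq> 0"
  proof (rule exists_line_avoiding_points[of "rep ` S" q])
    show "finite (rep ` S)" using S(1) by simp
    show "\<exists>r. triple v r q \<noteq> 0" if "v \<in> rep ` S" for v using that q(2) by auto
  qed auto
  obtain P0 where P0: "P0 \<in> S" using S(3) by blast
  define p where "p = rep P0"
  have T: "triple p u q \<noteq> 0" unfolding p_def by (rule u[OF P0])
  \<comment> \<open>the representative of \<open>P\<close> is rescaled to lie in the affine plane spanned from \<open>p\<close> by \<open>u\<close> and \<open>q\<close>\<close>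
  define \<alpha> where "\<alpha> P = triple (rep P) u q / triple p u q" for P
  define v where "v P = (1 / \<alpha> P) *s rep P" for P
  define x where "x P = triple p (rep P) q / triple p u q / \<alpha> P" for P
  define y where "y P = triple p u (rep P) / triple p u q / \<alpha> P" for P
  have \<alpha>: "\<alpha> P \<noteq> 0" if "P \<in> S" for P using u[OF that] T by (simp add: \<alpha>_def)
  have v_eq: "v P = p + x P *s u + y P *s q" if "P \<in> S" for P
  proof -
    have "v P = (1 / \<alpha> P) *s (\<alpha> P *s p + (\<alpha> P * x P) *s u + (\<alpha> P * y P) *s q)"
      unfolding v_def using triple_basis[OF T, of "rep P"] \<alpha>[OF that] by (simp add: \<alpha>_def x_def y_def)
    thus ?thesis using \<alpha>[OF that] by (simp add: vector_add_ldistrib vector_smult_assoc)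
  qed
  have v_in: "v P \<in> P" "v P \<noteq> 0" if "P \<in> S" for P
  proof -
    show "v P \<in> P" unfolding v_def using rep(2)[OF that] by (metis vec.span_base vec.span_scale singletonI)
    show "v P \<noteq> 0" unfolding v_def using rep(1)[OF that] \<alpha>[OF that] by simp
  qed
  have tv: "triple (v P) u q \<noteq> 0" if "P \<in> S" for P
  proof -
    have "triple (v P) u q = triple p u q" unfolding v_eq[OF that] by (simp add: triple_def algebra_simps)
    thus ?thesis using T by simp
  qed
  have inj_x: "inj_on x S"
  proof (rule inj_onI, rule ccontr)
    fix P P' assume PP: "P \<in> S" "P' \<in> S" "x P = x P'" "P \<noteq> P'"
    have "triple (v P) (v P') q = 0"
      unfolding v_eq[OF PP(1)] v_eq[OF PP(2)] PP(3) by (simp add: triple_def algebra_simps)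
    moreover have "triple (v P) (v P') q = (1 / \<alpha> P) * (1 / \<alpha> P') * triple (rep P) (rep P') q"
      unfolding v_def by (simp add: triple_def algebra_simps)
    ultimately show False using q(3)[OF PP(1,2,4)] \<alpha>[OF PP(1)] \<alpha>[OF PP(2)] by simp
  qed
  define G where "G = chart F p u q"
  define R where "R = resultant G (pderiv G)"
  have leaves: "\<exists>t. eval3 F (v P + t *s q) \<noteq> 0" if "P \<in> S" for P
  proof -
    have "triple (v P) q u = - triple (v P) u q" by (simp add: triple_def algebra_simps)
    hence "triple (v P) q u \<noteq> 0" using tv[OF that] by simp
    from line_leaves_irreducible_curve[OF irr F d this q(1)] show ?thesis by blast
  qed
  have order2: "[:- x P, 1:] ^ 2 dvd R" and deg1: "degree G \<ge> 1" if P: "P \<in> S" for P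
    using leaves[OF P] discriminant_order(1,3)[OF P[folded S(2)] v_in[OF P] v_eq[OF P]]
    unfolding R_def G_def by blast+
  have order3: "[:- x P, 1:] ^ 3 dvd R" if P: "P \<in> K" for P
  proof -
    have PS: "P \<in> S" using P by (simp add: S_def)
    have "chart_coeff F (v P) u q 1 1 ^ 2 = 4 * chart_coeff F (v P) u q 2 0 * chart_coeff F (v P) u q 0 2"
      using cusps P by (intro cusp_tangent_cone_degenerate[OF F _ v_in[OF PS] tv[OF PS]]) auto
    thus ?thesis using leaves[OF PS] discriminant_order(2)[OF PS[folded S(2)] v_in[OF PS] v_eq[OF PS]]
      unfolding R_def G_def by blast
  qed
  have R0: "R \<noteq> 0" unfolding R_def G_def
    by (rule discriminant_nonzero[OF F _ T]) (use S(1,2) deg1[OF P0] in \<open>simp_all add: G_def\<close>)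
  have "degree G \<le> d - 1"
  proof (rule degree_le, intro allI impI)
    fix j assume j: "d - 1 < j"
    show "coeff G j = 0"
    proof (cases "j = d")
      case True
      thus ?thesis by (simp add: G_def coeff_chart_degree[OF F] q(1))
    next
      case False
      hence "d < j" using j by simp
      thus ?thesis unfolding G_def by (rule coeff_eq_0_if_total_degree_le[OF total_degree_le_chart[OF F]])
    qed
  qed
  hence "degree R + d + 1 \<le> d * d" unfolding R_def
    using deg1[OF P0] R0 by (intro degree_discriminant_le) (auto simp: R_def G_def intro: total_degree_le_chart[OF F])
  moreover have "2 * card N + 3 * card K \<le> degree R"
  proof -
    have "2 * card N + 3 * card K = (\<Sum>P\<in>N. 2) + (\<Sum>P\<in>K. 3)" by simp
    also have "\<dots> \<le> (\<Sum>P\<in>N. order (x P) R) + (\<Sum>P\<in>K. order (x P) R)"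
    proof (intro add_mono sum_mono)
      show "2 \<le> order (x P) R" if "P \<in> N" for P
        using order_divides[THEN iffD1, OF order2[of P]] that R0 by (auto simp: S_def)
      show "3 \<le> order (x P) R" if "P \<in> K" for P
        using order_divides[THEN iffD1, OF order3[OF that]] R0 by auto
    qed
    also have "\<dots> = (\<Sum>P\<in>S. order (x P) R)" unfolding S_def using sing by (simp add: sum.union_disjoint)
    also have "\<dots> = (\<Sum>z\<in>x ` S. order z R)" by (simp add: sum.reindex[OF inj_x])
    also have "\<dots> \<le> degree R" using S(1) by (intro sum_order_le_degree R0) simp
    finally show ?thesis .
  qed
  ultimately show ?thesis by linarith
qed

text \<open>
  For \<open>d \<ge> 8\<close> real arithmetic suffices: \<open>8/3 (d\<^sup>2 - d - 1) \<le> 3 d\<^sup>2 - 6 d + 3\<close> amounts to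
  \<open>d\<^sup>2 - 10 d + 17 \<ge> 0\<close>.
\<close>

lemma cusp_bound_arithmetic:
  fixes a b d :: nat
  assumes "d \<ge> 2" and bound: "2 * a + 3 * b + d + 1 \<le> d * d"
  shows "4 * a + 8 * b + 6 * d \<le> 3 * (d * d) + (if odd d then 3 else 4)"
proof (cases "d \<ge> 8")
  case True
  then obtain k where k: "d = 8 + k" using le_Suc_ex by blast
  have "3 * (4 * a + 8 * b) \<le> 8 * (2 * a + 3 * b)" by simp
  also have "\<dots> + 8 * (d + 1) \<le> 8 * (d * d)" using bound by simp
  finally have "3 * (4 * a + 8 * b) + 8 * (d + 1) \<le> 8 * (d * d)" by simp
  hence "3 * (4 * a + 8 * b + 6 * d) \<le> 3 * (3 * (d * d) + 3)" unfolding k by (simp add: algebra_simps)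
  thus ?thesis by auto
next
  case False
  then consider "d = 2" | "d = 3" | "d = 4" | "d = 5" | "d = 6" | "d = 7" using assms(1) by linarith
  thus ?thesis
  proof cases
    case 1
    thus ?thesis using bound by simp
  next
    case 2
    hence "2 * a + 3 * b \<le> 5" using bound by simp
    hence "a + 2 * b \<le> 3" by presburger
    thus ?thesis using 2 by simp
  next
    case 3
    hence "2 * a + 3 * b \<le> 11" using bound by simp
    hence "a + 2 * b \<le> 7" by presburger
    thus ?thesis using 3 by simp
  next
    case 4
    hence "2 * a + 3 * b \<le> 19" using bound by simp
    hence "a + 2 * b \<le> 12" by presburger
    thus ?thesis using 4 by simp
  next
    case 5
    hence "2 * a + 3 * b \<le> 29" using bound by simp
    hence "a + 2 * b \<le> 19" by presburger
    thus ?thesis using 5 by simp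
  next
    case 6
    hence "2 * a + 3 * b \<le> 41" using bound by simp
    hence "a + 2 * b \<le> 27" by presburger
    thus ?thesis using 6 by simp
  qed
qed

theorem theorem7p2:
  fixes F :: poly3 and d a b :: nat and N K :: "(complex^3) set set"
  assumes "irreducible F" and "homogeneous_of_degree d F"
    and "singular_points F = N \<union> K" and "N \<inter> K = {}"
    and "finite N" and "card N = a" and "\<forall>P\<in>N. ordinary_double_point F P"
    and "finite K" and "card K = b" and "\<forall>P\<in>K. ordinary_cusp F P"
  shows "real b \<le> 1/2 * (real d - 1) * (real d - 2) - 1/2 * A_bound d - 1/2 * real a"
proof -
  have "4 * a + 8 * b + 6 * d \<le> 3 * (d * d) + (if odd d then 3 else 4)"
  proof (cases "N \<union> K = {}")
    case True
    hence "a = 0" "b = 0" using assms by auto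
    \<comment> \<open>without singular points the claim follows from \<open>0 \<le> 3 (d - 1)\<^sup>2\<close>\<close>
    moreover have "2 * d \<le> d * d + 1"
    proof (cases "d \<ge> 2")
      case True
      hence "2 * d \<le> d * d" by (intro mult_right_mono) auto
      thus ?thesis by linarith
    next
      case False
      hence "d = 0 \<or> d = 1" by auto
      thus ?thesis by auto
    qed
    ultimately show ?thesis by auto
  next
    case False
    have "2 * a + 3 * b + d + 1 \<le> d * d"
      using class_bound[OF assms(1,2,3,4,5,8) False assms(10)] assms(6,9) by simp
    moreover have "d \<ge> 2" using degree_ge_2_if_singular[OF assms(2)] assms(3) False by blast
    ultimately show ?thesis by (intro cusp_bound_arithmetic)
  qed
  hence "real (4 * a + 8 * b + 6 * d) \<le> real (3 * (d * d) + (if odd d then 3 else 4))"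
    by (rule of_nat_mono)
  hence "4 * real a + 8 * real b + 6 * real d \<le> 3 * (real d * real d) + (if odd d then 3 else 4)"
    by (cases "odd d") simp_all
  thus ?thesis by (simp add: A_bound_def field_simps power2_eq_square split: if_splits)
qed

end
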